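(* Let $s\geqslant 1$ be fixed. The following decision problem is decidable: given an orthogonal matrix $A\in \mathrm{O}_s(\mathbb{Q})$, decide whether $\mathrm{tr}(A^n)\geqslant 0$ for all $n\geqslant 0$ (the moment positivity problem for the instance set $\mathcal D=\mathrm{O}_s(\mathbb{Q})$ and $\mathcal P=\mathbb{R}_{\geqslant 0}$).
   Context: $\mathrm{O}_s(\mathbb{Q})$ is the set of orthogonal $s\times s$ matrices with rational entries. For a square matrix $A$, its $n$-th moment is $\mu_n(A)=\mathrm{tr}(A^n)$. Moment positivity problem, for fixed size $s$, fixed set $\mathcal P$ and fixed instance set $\mathcal D$ of $s\times s$ matrices: given $A\in\mathcal D$, decide whether all moments $\mu_n(A)$ belong to $\mathcal P$. It is called decidable if there is an algorithm (which may depend on $s,\mathcal P,\mathcal D$) that, on input any $A\in\mathcal D$, stops after finite time and answers yes if all moments of $A$ belong to $\mathcal P$, and no if at least one does not. *)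

theory Defs
  imports
    Complex_Main
    "HOL-Library.Nat_Bijection"
    "Jordan_Normal_Form.Matrix"
begin

section \<open>Algorithms: partial recursive functions\<close>

text \<open>
  Kleene's syntax of partial recursive functions on tuples of natural numbers.
  A program of this type is what we call an algorithm.
\<close>

datatype recf =
    Zero
  | Succ
  | Proj nat
  | Comp recf "recf list"
  | PrimRec recf recf
  | Mini recf

text \<open>
  \<open>computes p xs y\<close>: program \<open>p\<close> halts on the argument tuple \<open>xs\<close> with result \<open>y\<close>.
  If no such \<open>y\<close> exists, then \<open>p\<close> does not halt (or gets stuck) on \<open>xs\<close>. In the rule for
  minimisation, \<open>f\<close> must halt with a nonzero value on every number below the result.
\<close>

inductive computes :: "recf \<Rightarrow> nat list \<Rightarrow> nat \<Rightarrow> bool" where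
  zero: "computes Zero xs 0"
| succ: "computes Succ [x] (Suc x)"
| proj: "i < length xs \<Longrightarrow> computes (Proj i) xs (xs ! i)"
| comp: "list_all2 (\<lambda>g y. computes g xs y) gs ys \<Longrightarrow> computes f ys z
    \<Longrightarrow> computes (Comp f gs) xs z"
| prim_0: "computes f xs z \<Longrightarrow> computes (PrimRec f g) (0 # xs) z"
| prim_Suc: "computes (PrimRec f g) (n # xs) r \<Longrightarrow> computes g (n # r # xs) z
    \<Longrightarrow> computes (PrimRec f g) (Suc n # xs) z"
| mini: "computes f (n # xs) 0 \<Longrightarrow> (\<And>m. m < n \<Longrightarrow> \<exists>k. computes f (m # xs) (Suc k))
    \<Longrightarrow> computes (Mini f) xs n"

lemma computes_deterministic:
  assumes "computes p xs y" and "computes p xs z"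
  shows "y = z"
  using assms
proof (induction arbitrary: z rule: computes.induct)
  case (zero xs)
  then show ?case by (auto elim: computes.cases)
next
  case (succ x)
  then show ?case by (auto elim: computes.cases)
next
  case (proj i xs)
  from proj.prems show ?case by (cases) auto
next
  case (comp xs gs ys f y)
  from comp.prems show ?case
  proof cases
    case (comp ys')
    have "ys = ys'"
    proof (rule nth_equalityI)
      show "length ys = length ys'"
        using comp.IH(1) comp(1) by (auto simp: list_all2_conv_all_nth)
      show "ys ! i = ys' ! i" if "i < length ys" for i
        using comp.IH(1) comp(1) that by (auto simp: list_all2_conv_all_nth)
    qed
    then show ?thesis using comp(2) comp.IH(2) by blast
  qed
next
  case (prim_0 f xs y g)
  from prim_0.prems show ?case by cases (auto dest: prim_0.IH)
next
  case (prim_Suc f g n xs r y)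
  from prim_Suc.prems show ?case
    by cases (use prim_Suc.IH in blast)
next
  case (mini f n xs)
  from mini.prems show ?case
  proof cases
    case min': mini
    have "\<not> z < n" using mini.IH(2)[of z] min'(1) by fastforce
    moreover have "\<not> n < z" using min'(2)[of n] mini.IH(1) by fastforce
    ultimately show ?thesis by simp
  qed
qed

text \<open>
  The problem \<open>Q\<close> on the instance set \<open>D\<close>, where instances are presented through the encoding
  \<open>code\<close>, is decidable: a single program halts on every instance in \<open>D\<close> with the correct answer
  (1 for yes, 0 for no). Inputs that do not encode an instance in \<open>D\<close> are unconstrained.
\<close>

definition decidable :: "('a \<Rightarrow> nat list) \<Rightarrow> 'a set \<Rightarrow> ('a \<Rightarrow> bool) \<Rightarrow> bool" where
  "decidable code D Q \<longleftrightarrow>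
    (\<exists>p. \<forall>A\<in>D. computes p (code A) (if Q A then 1 else 0))"


section \<open>Encoding of rational matrices\<close>

text \<open>
  A rational number is given by the numerator and the denominator of its reduced fraction,
  the denominator being positive.
\<close>

definition rat_code :: "rat \<Rightarrow> nat list" where
  "rat_code q = (case quotient_of q of (a, b) \<Rightarrow> [int_encode a, nat b])"

text \<open>
  Entries are listed row by row; for \<open>s \<times> s\<close> matrices this is a tuple of length \<open>2 * s * s\<close>.
\<close>

definition mat_code :: "rat mat \<Rightarrow> nat list" where
  "mat_code A = concat (map rat_code (concat (mat_to_list A)))"

lemma length_rat_code: "length (rat_code q) = 2"
  by (simp add: rat_code_def split: prod.split)

lemma rat_code_inj: "rat_code q = rat_code r \<longleftrightarrow> q = r"
proof
  assume *: "rat_code q = rat_code r"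
  obtain a b where q: "quotient_of q = (a, b)" by fastforce
  obtain c d where r: "quotient_of r = (c, d)" by fastforce
  have "b > 0" "d > 0" using q r quotient_of_denom_pos by auto
  then have "quotient_of q = quotient_of r"
    using * q r by (simp add: rat_code_def eq_nat_nat_iff int_encode_eq)
  then show "q = r" by (rule quotient_of_inject)
qed simp

lemma concat_rat_code_inj:
  "concat (map rat_code xs) = concat (map rat_code ys) \<Longrightarrow> xs = ys"
proof (induction xs arbitrary: ys)
  case Nil
  then show ?case
  proof (cases ys)
    case (Cons y ys')
    then show ?thesis using Nil.prems length_rat_code[of y] by auto
  qed simp
next
  case (Cons x xs)
  show ?case
  proof (cases ys)
    case Nil
    then show ?thesis using Cons.prems length_rat_code[of x] by auto
  next
    case ys: (Cons y ys')
    then show ?thesis using Cons by (simp add: length_rat_code rat_code_inj)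
  qed
qed

lemma inj_on_mat_code: "inj_on mat_code (carrier_mat n m)"
proof (rule inj_onI)
  fix A B assume A: "A \<in> carrier_mat n m" and B: "B \<in> carrier_mat n m"
    and eq: "mat_code A = mat_code B"
  have c: "concat (mat_to_list A) = concat (mat_to_list B)"
    using eq concat_rat_code_inj unfolding mat_code_def by blast
  have "mat_to_list A = mat_to_list B"
    by (rule concat_injective[OF c])
      (use A B in \<open>auto simp: mat_to_list_def set_zip\<close>)
  then have "A $$ (i, j) = B $$ (i, j)" if "i < n" "j < m" for i j
    using A B that by (auto simp: mat_to_list_def)
  then show "A = B" using A B by (intro eq_matI) auto
qed


section \<open>The moment positivity problem\<close>

definition mat_trace :: "'a::comm_monoid_add mat \<Rightarrow> 'a" where
  "mat_trace A = (\<Sum>i<dim_row A. A $$ (i, i))"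

definition moment :: "nat \<Rightarrow> 'a::semiring_1 mat \<Rightarrow> 'a" where
  "moment n A = mat_trace (A ^\<^sub>m n)"

definition all_moments_in :: "real set \<Rightarrow> rat mat \<Rightarrow> bool" where
  "all_moments_in P A \<longleftrightarrow> (\<forall>n. of_rat (moment n A) \<in> P)"

definition moment_positivity_decidable :: "real set \<Rightarrow> rat mat set \<Rightarrow> bool" where
  "moment_positivity_decidable P D \<longleftrightarrow> decidable mat_code D (all_moments_in P)"

text \<open>
  The library predicate \<open>orthogonal_mat\<close> only requires the columns to be pairwise orthogonal and
  nonzero; the usual notion requires them to be orthonormal.
\<close>

definition orthogonal_group_rat :: "nat \<Rightarrow> rat mat set" where
  "orthogonal_group_rat s =
    {A \<in> carrier_mat s s. transpose_mat A * A = 1\<^sub>m s \<and> A * transpose_mat A = 1\<^sub>m s}"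

end

theory Submission
  imports
    Defs
    "HOL-Library.FuncSet"
    "HOL-Real_Asymp.Real_Asymp"
    "Jordan_Normal_Form.Schur_Decomposition"
begin

text \<open>
  For fixed \<open>s\<close> there is a single polynomial \<open>\<Phi>\<close> with integer coefficients such that an orthogonal
  rational matrix \<open>A\<close> has only nonnegative moments if and only if \<open>\<Phi>\<close> vanishes at finitely many of its
  moments (\<open>all_moments_nonneg_iff_zero\<close>). The decision procedure evaluates \<open>\<Phi>\<close> and tests the result
  for zero. Only the existence of \<open>\<Phi>\<close> is shown; this is enough, because the program may depend on \<open>s\<close>.

  The eigenvalues of \<open>A\<close> form a point \<open>z\<close> of the torus \<open>T\<^sup>s\<close>, \<open>T\<close> being the unit circle, and
  the moments are the sums of its powers. Let \<open>X\<close> be the set of those \<open>z\<close> in the torus for which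
  every \<open>\<Sum>\<^sub>i z\<^sub>i\<^sup>n\<close> has nonnegative real part. The key fact (\<open>nonneg_points_finite_union\<close>) is that
  \<open>X\<close> is a finite union of closed subgroups of the torus, each of them cut out by finitely many
  equations \<open>z\<^sup>v = 1\<close> with \<open>v \<in> \<int>\<^sup>s\<close>. Two ingredients prove it.

  \<^item> A form of Kronecker's theorem that is uniform in \<open>z\<close> (\<open>uniform_kronecker\<close>): for every \<open>\<epsilon>\<close> there
    is \<open>N\<close>, depending only on \<open>s\<close> and \<open>\<epsilon>\<close>, such that the powers of \<open>z\<close> come \<open>\<epsilon>\<close>-close to every point
    \<open>w\<close> that satisfies those multiplicative relations of \<open>z\<close> whose exponents are at most \<open>N\<close> in
    absolute value.
  \<^item> Ascending chains of subgroups of \<open>\<int>\<^sup>s\<close> become stationary (\<open>int_subgroup_chain_stabilizes\<close>).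

  Let \<open>H\<close> be a subgroup given by finitely many relations. If \<open>H\<close> is not contained in \<open>X\<close>, it contains
  a point \<open>w\<close> with \<open>Re \<Sum>\<^sub>i w\<^sub>i < 0\<close>. By the first ingredient, every point of \<open>X \<inter> H\<close> satisfies a
  relation from a fixed finite set that fails at \<open>w\<close>. So \<open>X \<inter> H\<close> is covered by finitely many
  smaller subgroups, and the second ingredient makes this splitting terminate
  (\<open>nonneg_points_cover\<close>).

  On the torus \<open>2 - z\<^sup>v - z\<^sup>-\<^sup>v = |z\<^sup>v - 1|\<^sup>2\<close>. Summing over the relations of one subgroup and multiplying
  over the subgroups gives a nonnegative Laurent polynomial with zero set \<open>X\<close>. As \<open>X\<close> is invariant
  under permutations of the coordinates, the symmetrised polynomial has the same zero set, and a
  symmetric Laurent polynomial is a polynomial in the power sums of positive and negative order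
  (\<open>power_sum_poly_symmetrised_laurent\<close>). The power sum of order \<open>m\<close> is the moment of order
  \<open>|m|\<close>, because moments are rational and the inverse of an eigenvalue is its complex conjugate.
\<close>


section \<open>Characters of the torus\<close>

definition torus :: "nat \<Rightarrow> (nat \<Rightarrow> complex) set" where
  "torus s = {z. \<forall>i<s. cmod (z i) = 1}"

definition character :: "nat \<Rightarrow> (nat \<Rightarrow> int) \<Rightarrow> (nat \<Rightarrow> complex) \<Rightarrow> complex" where
  "character s v z = (\<Prod>i<s. z i powi v i)"

text \<open>
  The lattice \<open>\<int>\<^sup>s\<close>. Setting the coordinates from \<open>s\<close> on to zero gives a character of the torus a
  unique exponent vector.
\<close>

definition int_vecs :: "nat \<Rightarrow> (nat \<Rightarrow> int) set" where
  "int_vecs s = {v. \<forall>i\<ge>s. v i = 0}"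

lemma torusD: "z \<in> torus s \<Longrightarrow> i < s \<Longrightarrow> cmod (z i) = 1"
  by (simp add: torus_def)

lemma torus_nonzero: "z \<in> torus s \<Longrightarrow> i < s \<Longrightarrow> z i \<noteq> 0"
  using torusD by fastforce

lemma torus_power: "z \<in> torus s \<Longrightarrow> (\<lambda>i. z i ^ n) \<in> torus s"
  by (simp add: torus_def norm_power)

lemma norm_character: "z \<in> torus s \<Longrightarrow> cmod (character s v z) = 1"
  unfolding character_def by (auto simp: prod_norm[symmetric] norm_power_int torusD intro!: prod.neutral)

lemma character_zero: "character s (\<lambda>_. 0) z = 1"
  by (simp add: character_def)

lemma character_add:
  "z \<in> torus s \<Longrightarrow> character s (\<lambda>i. v i + w i) z = character s v z * character s w z"
  by (simp add: character_def power_int_add torus_nonzero prod.distrib)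

lemma character_diff:
  "z \<in> torus s \<Longrightarrow> character s (\<lambda>i. v i - w i) z = character s v z / character s w z"
  by (simp add: character_def power_int_diff torus_nonzero prod_dividef)

lemma character_uminus: "character s (\<lambda>i. - v i) z = inverse (character s v z)"
  by (simp add: character_def power_int_minus prod_inversef[symmetric])

lemma character_mult_point: "character s v (\<lambda>i. z i * w i) = character s v z * character s v w"
  by (simp add: character_def power_int_mult_distrib prod.distrib)

lemma character_inverse_point: "character s v (\<lambda>i. inverse (z i)) = inverse (character s v z)"
  by (simp add: character_def power_int_inverse prod_inversef[symmetric])

lemma character_power_point: "character s v (\<lambda>i. z i ^ n) = character s v z ^ n"
proof -
  have "(z i ^ n) powi v i = (z i powi v i) ^ n" for i
    by (metis mult.commute power_int_mult power_int_of_nat)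
  then show ?thesis by (simp add: character_def prod_power_distrib)
qed


section \<open>A uniform form of Kronecker's theorem\<close>

text \<open>
  A bump function on the torus: it takes values in \<open>[0, 1]\<close> and concentrates at \<open>(1, \<dots>, 1)\<close> as
  \<open>N\<close> grows. It is a trigonometric polynomial with nonnegative coefficients, and its constant
  term decays only polynomially in \<open>N\<close>, while away from \<open>(1, \<dots>, 1)\<close> its values decay exponentially.
\<close>

definition kernel :: "nat \<Rightarrow> nat \<Rightarrow> (nat \<Rightarrow> complex) \<Rightarrow> real" where
  "kernel s N u = (\<Prod>i<s. ((1 + Re (u i)) / 2) ^ N)"

definition int_box :: "nat \<Rightarrow> nat \<Rightarrow> (nat \<Rightarrow> int) set" where
  "int_box s N = {v \<in> int_vecs s. \<forall>i. \<bar>v i\<bar> \<le> int N}"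

lemma finite_int_box: "finite (int_box s N)"
proof (rule finite_subset)
  show "int_box s N \<subseteq> {v. \<forall>i. (i \<in> {..<s} \<longrightarrow> v i \<in> {- int N..int N}) \<and> (i \<notin> {..<s} \<longrightarrow> v i = 0)}"
    by (auto simp: int_box_def int_vecs_def abs_le_iff minus_le_iff not_less)
  show "finite \<dots>"
    by (rule finite_set_of_finite_funs) auto
qed

text \<open>
  On the unit circle \<open>(1 + Re u) / 2 = (1 + u)\<^sup>2 / (4 u)\<close>, so the binomial theorem applies.
\<close>

lemma one_dim_kernel_expansion:
  assumes "cmod u = 1"
  shows "complex_of_real (((1 + Re u) / 2) ^ N)
    = (\<Sum>j\<le>2 * N. of_real (real (2 * N choose j) / 4 ^ N) * u powi (int j - int N))"
proof -
  have u0: "u \<noteq> 0" using assms by auto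
  have "cnj u * u = 1"
    using assms by (metis complex_norm_square mult.commute of_real_1 power_one)
  moreover have "2 * complex_of_real (Re u) = u + cnj u"
    by (simp add: complex_add_cnj)
  ultimately have "u * (2 + 2 * complex_of_real (Re u)) = (1 + u) ^ 2"
    by (simp only:) (simp add: algebra_simps power2_eq_square)
  then have "complex_of_real ((1 + Re u) / 2) = (1 + u) ^ 2 / (4 * u)"
    using u0 by (simp add: field_simps)
  then have "complex_of_real (((1 + Re u) / 2) ^ N) = ((1 + u) ^ 2 / (4 * u)) ^ N"
    by (simp only: of_real_power)
  also have "\<dots> = (1 + u) ^ (2 * N) / (4 ^ N * u ^ N)"
    by (simp only: power_divide power_mult power_mult_distrib)
  also have "(1 + u) ^ (2 * N) = (\<Sum>j\<le>2 * N. of_nat (2 * N choose j) * u ^ j)"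
    using binomial_ring[of u 1 "2 * N"] by (simp add: add.commute)
  also have "\<dots> / (4 ^ N * u ^ N)
      = (\<Sum>j\<le>2 * N. of_real (real (2 * N choose j) / 4 ^ N) * u powi (int j - int N))"
    unfolding sum_divide_distrib
    by (intro sum.cong refl) (simp add: power_int_diff u0)
  finally show ?thesis .
qed

lemma kernel_expansion:
  assumes "u \<in> torus s"
  shows "complex_of_real (kernel s N u)
    = (\<Sum>g\<in>PiE {..<s} (\<lambda>_. {..2 * N}). of_real (\<Prod>i<s. real (2 * N choose g i) / 4 ^ N)
        * character s (\<lambda>i. if i < s then int (g i) - int N else 0) u)"
proof -
  have "complex_of_real (kernel s N u) = (\<Prod>i<s. complex_of_real (((1 + Re (u i)) / 2) ^ N))"
    by (simp add: kernel_def)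
  also have "\<dots> = (\<Prod>i<s. \<Sum>j\<le>2 * N. of_real (real (2 * N choose j) / 4 ^ N) * u i powi (int j - int N))"
    by (intro prod.cong refl one_dim_kernel_expansion) (use assms torusD in auto)
  also have "\<dots> = (\<Sum>g\<in>PiE {..<s} (\<lambda>_. {..2 * N}). \<Prod>i<s.
      of_real (real (2 * N choose g i) / 4 ^ N) * u i powi (int (g i) - int N))"
    by (rule prod_sum_PiE) auto
  finally have "complex_of_real (kernel s N u) = (\<Sum>g\<in>PiE {..<s} (\<lambda>_. {..2 * N}).
      \<Prod>i<s. of_real (real (2 * N choose g i) / 4 ^ N) * u i powi (int (g i) - int N))" .
  moreover have "character s (\<lambda>i. if i < s then int (g i) - int N else 0) u
      = (\<Prod>i<s. u i powi (int (g i) - int N))" for g :: "nat \<Rightarrow> nat"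
    by (simp add: character_def)
  ultimately show ?thesis
    by (simp only: prod.distrib of_real_prod)
qed

text \<open>
  Averaging a character over the powers of a point detects whether it is a relation of the point.
\<close>

lemma mean_powers_tendsto:
  fixes \<zeta> :: complex
  assumes "cmod \<zeta> = 1"
  shows "(\<lambda>M. (\<Sum>n<M. \<zeta> ^ n) / of_nat M) \<longlonglongrightarrow> of_bool (\<zeta> = 1)"
proof (cases "\<zeta> = 1")
  case True
  have "eventually (\<lambda>M. (\<Sum>n<M. \<zeta> ^ n) / of_nat M = 1) sequentially"
    using eventually_gt_at_top[of 0] by eventually_elim (simp add: True)
  then show ?thesis using True by (simp add: tendsto_eventually)
next
  case False
  have "norm ((\<Sum>n<M. \<zeta> ^ n) / of_nat M) \<le> (2 / cmod (\<zeta> - 1)) * inverse (real M)" for M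
  proof -
    have "cmod (\<zeta> ^ M - 1) \<le> 2"
      using norm_triangle_ineq4[of "\<zeta> ^ M" 1] assms by (simp add: norm_power)
    then show ?thesis
      by (simp add: geometric_sum[OF False] norm_mult norm_inverse divide_inverse mult_right_mono)
  qed
  then have "(\<lambda>M. (\<Sum>n<M. \<zeta> ^ n) / of_nat M) \<longlonglongrightarrow> 0"
    by (intro tendsto_0_le[OF lim_inverse_n, where K = "2 / cmod (\<zeta> - 1)"] always_eventually)
      (simp add: norm_inverse mult_ac)
  then show ?thesis using False by simp
qed

text \<open>
  The mean of the kernel, centred at \<open>w\<close>, over the powers of \<open>z\<close> is the sum of its coefficients at
  the relations of \<open>z\<close>: the other terms average out, and the factors \<open>w\<^sup>-\<^sup>v\<close> that come from the centring
  equal 1 at these relations. As all coefficients are nonnegative, the mean is at least the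
  constant term.
\<close>

lemma kernel_mean_bound:
  assumes z: "z \<in> torus s" and w: "w \<in> torus s"
    and rel: "\<And>v. v \<in> int_box s N \<Longrightarrow> character s v z = 1 \<Longrightarrow> character s v w = 1"
    and bound: "\<And>n. kernel s N (\<lambda>i. z i ^ n * inverse (w i)) \<le> c"
  shows "(real (2 * N choose N) / 4 ^ N) ^ s \<le> c"
proof -
  let ?G = "PiE {..<s} (\<lambda>_. {..2 * N})"
  define coef where "coef g = (\<Prod>i<s. real (2 * N choose g i) / 4 ^ N)" for g :: "nat \<Rightarrow> nat"
  define expo where "expo g = (\<lambda>i. if i < s then int (g i) - int N else 0)" for g :: "nat \<Rightarrow> nat"
  let ?\<chi> = "\<lambda>g. character s (expo g)"
  define mean where "mean M = (\<Sum>n<M. kernel s N (\<lambda>i. z i ^ n * inverse (w i))) / real M" for M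
  have fin: "finite ?G" by (rule finite_PiE) auto
  have coef_nonneg: "0 \<le> coef g" for g
    unfolding coef_def by (intro prod_nonneg) simp
  have box: "expo g \<in> int_box s N" if "g \<in> ?G" for g
    using PiE_mem[OF that] by (force simp: int_box_def int_vecs_def expo_def)
  have "(\<lambda>i. z i ^ n * inverse (w i)) \<in> torus s" for n
    using z w by (simp add: torus_def norm_mult norm_power norm_inverse)
  then have ker: "complex_of_real (kernel s N (\<lambda>i. z i ^ n * inverse (w i)))
      = (\<Sum>g\<in>?G. of_real (coef g) * inverse (?\<chi> g w) * ?\<chi> g z ^ n)" for n
    by (simp add: kernel_expansion character_mult_point character_inverse_point
        character_power_point coef_def expo_def mult_ac)
  have "complex_of_real (mean M)
      = (\<Sum>g\<in>?G. of_real (coef g) * inverse (?\<chi> g w) * ((\<Sum>n<M. ?\<chi> g z ^ n) / of_nat M))" for M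
  proof -
    have "complex_of_real (mean M)
        = (\<Sum>n<M. \<Sum>g\<in>?G. of_real (coef g) * inverse (?\<chi> g w) * ?\<chi> g z ^ n) / of_nat M"
      by (simp add: mean_def ker)
    also have "\<dots> = (\<Sum>g\<in>?G. \<Sum>n<M. of_real (coef g) * inverse (?\<chi> g w) * ?\<chi> g z ^ n) / of_nat M"
      by (subst sum.swap) simp
    finally show ?thesis
      by (simp add: sum_divide_distrib sum_distrib_left)
  qed
  moreover have "(\<lambda>M. \<Sum>g\<in>?G. of_real (coef g) * inverse (?\<chi> g w) * ((\<Sum>n<M. ?\<chi> g z ^ n) / of_nat M))
      \<longlonglongrightarrow> (\<Sum>g\<in>?G. of_real (coef g) * inverse (?\<chi> g w) * of_bool (?\<chi> g z = 1))"
    by (intro tendsto_intros mean_powers_tendsto norm_character z)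
  moreover have "(\<Sum>g\<in>?G. of_real (coef g) * inverse (?\<chi> g w) * of_bool (?\<chi> g z = 1))
      = complex_of_real (\<Sum>g\<in>?G. coef g * of_bool (?\<chi> g z = 1))"
    unfolding of_real_sum by (intro sum.cong refl) (use rel box in auto)
  ultimately have "(\<lambda>M. complex_of_real (mean M)) \<longlonglongrightarrow> complex_of_real (\<Sum>g\<in>?G. coef g * of_bool (?\<chi> g z = 1))"
    by simp
  then have lim: "mean \<longlonglongrightarrow> (\<Sum>g\<in>?G. coef g * of_bool (?\<chi> g z = 1))"
    using tendsto_of_real_iff by blast
  have "eventually (\<lambda>M. mean M \<le> c) sequentially"
    using eventually_gt_at_top[of 0]
  proof eventually_elim
    case (elim M)
    have "(\<Sum>n<M. kernel s N (\<lambda>i. z i ^ n * inverse (w i))) \<le> real M * c"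
      using sum_bounded_above[of "{..<M}" _ c] bound by simp
    then show ?case using elim by (simp add: mean_def field_simps)
  qed
  then have le: "(\<Sum>g\<in>?G. coef g * of_bool (?\<chi> g z = 1)) \<le> c"
    by (rule tendsto_upperbound[OF lim]) simp
  \<comment> \<open>The constant term of the kernel belongs to the trivial character, a relation of every point.\<close>
  define g0 where "g0 = (\<lambda>i\<in>{..<s}. N)"
  have g0: "g0 \<in> ?G" by (auto simp: g0_def)
  have "expo g0 = (\<lambda>_. 0)" by (auto simp: expo_def g0_def)
  then have "coef g0 = coef g0 * of_bool (?\<chi> g0 z = 1)"
    by (simp add: character_zero)
  also have "\<dots> \<le> (\<Sum>g\<in>?G. coef g * of_bool (?\<chi> g z = 1))"
    using fin coef_nonneg
    by (intro member_le_sum[where f = "\<lambda>g. coef g * of_bool (?\<chi> g z = 1)", OF g0]) simp_all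
  finally have "coef g0 \<le> c" using le by simp
  moreover have "coef g0 = (real (2 * N choose N) / 4 ^ N) ^ s"
    by (simp add: coef_def g0_def)
  ultimately show ?thesis by simp
qed

lemma kernel_away_bound:
  assumes u: "u \<in> torus s" and i: "i < s" "cmod (u i - 1) \<ge> \<epsilon>" and \<epsilon>: "\<epsilon> > 0"
  shows "kernel s N u \<le> (1 - \<epsilon>\<^sup>2 / 4) ^ N"
proof -
  have factor: "0 \<le> (1 + Re (u k)) / 2" "(1 + Re (u k)) / 2 \<le> 1" if "k < s" for k
    using abs_Re_le_cmod[of "u k"] torusD[OF u that] by auto
  have "(cmod (u i - 1))\<^sup>2 = (Re (u i))\<^sup>2 + (Im (u i))\<^sup>2 + 1 - 2 * Re (u i)"
    by (simp add: cmod_power2 power2_diff)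
  also have "(Re (u i))\<^sup>2 + (Im (u i))\<^sup>2 = 1"
    using torusD[OF u i(1)] by (simp flip: cmod_power2)
  finally have "2 - 2 * Re (u i) \<ge> \<epsilon>\<^sup>2"
    using power_mono[OF i(2), of 2] \<epsilon> by simp
  then have small: "(1 + Re (u i)) / 2 \<le> 1 - \<epsilon>\<^sup>2 / 4" by simp
  have "kernel s N u = ((1 + Re (u i)) / 2) ^ N * (\<Prod>k\<in>{..<s} - {i}. ((1 + Re (u k)) / 2) ^ N)"
    unfolding kernel_def using i(1) by (subst prod.remove[of _ i]) auto
  also have "\<dots> \<le> (1 - \<epsilon>\<^sup>2 / 4) ^ N * 1"
    using factor small i(1)
    by (intro mult_mono power_mono prod_le_1 prod_nonneg)
      (auto intro!: power_le_one zero_le_power order_trans[OF factor(1)[OF i(1)] small])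
  finally show ?thesis by simp
qed

text \<open>
  If all powers of \<open>z\<close> stayed away from \<open>w\<close>, the kernel centred at \<open>w\<close> would be exponentially small in
  \<open>N\<close> along them, against the polynomial lower bound for its mean. Both bounds depend only on
  \<open>s\<close> and \<open>\<epsilon>\<close>, which is why a single \<open>N\<close> works for all points.
\<close>

theorem uniform_kronecker:
  assumes "\<epsilon> > 0"
  obtains N where "\<And>z w. z \<in> torus s \<Longrightarrow> w \<in> torus s \<Longrightarrow>
      (\<And>v. v \<in> int_box s N \<Longrightarrow> character s v z = 1 \<Longrightarrow> character s v w = 1) \<Longrightarrow>
      \<exists>n. \<forall>i<s. cmod (z i ^ n - w i) < \<epsilon>"
proof -
  \<comment> \<open>The base \<open>1 - \<epsilon>\<^sup>2 / 4\<close> of the exponential bound is only useful when it lies strictly between 0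
    and 1; a smaller radius is harmless.\<close>
  define \<delta> where "\<delta> = min \<epsilon> 1"
  have \<delta>: "0 < \<delta>" "\<delta> \<le> 1" "\<delta> \<le> \<epsilon>" using assms by (auto simp: \<delta>_def)
  define c where "c = 1 - \<delta>\<^sup>2 / 4"
  have c: "0 < c" "c < 1" using \<delta> power_le_one[of \<delta> 2] by (auto simp: c_def)
  have "(\<lambda>N. c ^ N * (2 * real N) ^ s) \<longlonglongrightarrow> 0" using c by real_asymp
  then have "eventually (\<lambda>N. c ^ N * (2 * real N) ^ s < 1) sequentially"
    by (rule order_tendstoD) simp
  then have "eventually (\<lambda>N. c ^ N * (2 * real N) ^ s < 1 \<and> N > 0) sequentially"
    using eventually_gt_at_top[of 0] by (rule eventually_conj)
  then obtain N where N: "c ^ N * (2 * real N) ^ s < 1" "N > 0"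
    by (auto simp: eventually_sequentially)
  have "c ^ N < (1 / (2 * real N)) ^ s"
    using N by (simp add: power_one_over field_simps)
  also have "\<dots> \<le> (real (2 * N choose N) / 4 ^ N) ^ s"
    using central_binomial_lower_bound[OF N(2)] N(2)
    by (intro power_mono) (auto simp: field_simps)
  finally have gap: "c ^ N < (real (2 * N choose N) / 4 ^ N) ^ s" .
  have "\<exists>n. \<forall>i<s. cmod (z i ^ n - w i) < \<epsilon>"
    if z: "z \<in> torus s" and w: "w \<in> torus s"
      and rel: "\<And>v. v \<in> int_box s N \<Longrightarrow> character s v z = 1 \<Longrightarrow> character s v w = 1" for z w
  proof (rule ccontr)
    assume far: "\<nexists>n. \<forall>i<s. cmod (z i ^ n - w i) < \<epsilon>"
    have "kernel s N (\<lambda>i. z i ^ n * inverse (w i)) \<le> c ^ N" for n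
    proof -
      obtain i where i: "i < s" "cmod (z i ^ n - w i) \<ge> \<epsilon>"
        using far by (meson not_less)
      have "z i ^ n * inverse (w i) - 1 = (z i ^ n - w i) * inverse (w i)"
        using torus_nonzero[OF w i(1)] by (simp add: field_simps)
      then have "cmod (z i ^ n * inverse (w i) - 1) = cmod (z i ^ n - w i)"
        using torusD[OF w i(1)] by (simp add: norm_mult norm_inverse)
      then have "cmod (z i ^ n * inverse (w i) - 1) \<ge> \<delta>" using i(2) \<delta>(3) by simp
      then show ?thesis
        unfolding c_def using z w i(1) \<delta>(1)
        by (intro kernel_away_bound[of _ _ i]) (auto simp: torus_def norm_mult norm_power norm_inverse)
    qed
    from kernel_mean_bound[OF z w rel this] gap show False by simp
  qed
  then show ?thesis using that by blast
qed


section \<open>Ascending chains of subgroups of the integer lattice\<close>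

definition int_subgroup :: "nat \<Rightarrow> (nat \<Rightarrow> int) set \<Rightarrow> bool" where
  "int_subgroup s L \<longleftrightarrow> L \<subseteq> int_vecs s \<and> (\<lambda>_. 0) \<in> L \<and> (\<forall>v\<in>L. \<forall>w\<in>L. (\<lambda>i. v i - w i) \<in> L)"

lemma int_subgroup_diff: "int_subgroup s L \<Longrightarrow> v \<in> L \<Longrightarrow> w \<in> L \<Longrightarrow> (\<lambda>i. v i - w i) \<in> L"
  by (simp add: int_subgroup_def)

lemma int_subgroup_add:
  assumes "int_subgroup s L" and "v \<in> L" and "w \<in> L"
  shows "(\<lambda>i. v i + w i) \<in> L"
proof -
  have "(\<lambda>i. 0 - w i) \<in> L"
    using assms by (intro int_subgroup_diff[where v = "\<lambda>_. 0"]) (auto simp: int_subgroup_def)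
  from int_subgroup_diff[OF assms(1,2) this] show ?thesis by simp
qed

lemma int_subgroup_scale:
  assumes "int_subgroup s L" and "v \<in> L"
  shows "(\<lambda>i. q * v i) \<in> L"
proof (induction q rule: int_induct[where k = 0])
  case base
  show ?case using assms by (simp add: int_subgroup_def)
next
  case (step1 q)
  from int_subgroup_add[OF assms(1) step1(2) assms(2)] show ?case by (simp add: algebra_simps)
next
  case (step2 q)
  from int_subgroup_diff[OF assms(1) step2(2) assms(2)] show ?case by (simp add: algebra_simps)
qed

text \<open>
  Induction on the rank. A subgroup of a larger one is equal to it as soon as both have the same
  last coordinates and the same elements with last coordinate zero; the former are ideals of \<open>\<int>\<close>, the
  latter subgroups of a lattice of smaller rank.
\<close>

lemma int_subgroup_chain_stabilizes:
  assumes "\<And>k. int_subgroup s (L k)" and "\<And>k. L k \<subseteq> L (Suc k)"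
  shows "\<exists>N. \<forall>k\<ge>N. L k = L N"
  using assms
proof (induction s arbitrary: L)
  case 0
  have "L k = {\<lambda>_. 0}" for k
    using 0(1)[of k] by (auto simp: int_subgroup_def int_vecs_def)
  then show ?case by blast
next
  case (Suc s)
  have mono: "L k \<subseteq> L l" if "k \<le> l" for k l
    using lift_Suc_mono_le[of L, OF Suc.prems(2) that] .
  define K where "K k = {v \<in> L k. v s = 0}" for k
  have vecs: "v \<in> int_vecs s" if "v \<in> int_vecs (Suc s)" "v s = 0" for v
    using that by (auto simp: int_vecs_def) (metis Suc_leI le_neq_implies_less)
  have "int_subgroup s (K k)" for k
    using Suc.prems(1)[of k] unfolding int_subgroup_def K_def by (auto intro!: vecs)
  moreover have "K k \<subseteq> K (Suc k)" for k
    using Suc.prems(2) by (auto simp: K_def)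
  ultimately obtain N1 where N1: "\<And>k. k \<ge> N1 \<Longrightarrow> K k = K N1"
    using Suc.IH by meson
  show ?case
  proof (cases "\<forall>k. \<forall>v\<in>L k. v s = 0")
    case True
    then have "L k = K k" for k by (auto simp: K_def)
    then show ?thesis using N1 by metis
  next
    case False
    \<comment> \<open>The last coordinates of the union of the chain form an ideal of the integers; the vector
      \<open>v\<close> provides its positive generator.\<close>
    let ?P = "\<lambda>m. 0 < m \<and> (\<exists>k. \<exists>v\<in>L k. v s = int m)"
    obtain k v where kv: "v \<in> L k" "v s \<noteq> 0" using False by blast
    have "\<exists>m. ?P m"
    proof (cases "v s > 0")
      case True
      then show ?thesis using kv by (intro exI[of _ "nat (v s)"]) auto
    next
      case False
      have "(\<lambda>i. (- 1) * v i) \<in> L k" by (rule int_subgroup_scale[OF Suc.prems(1) kv(1)])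
      then show ?thesis using False kv by (intro exI[of _ "nat (- v s)"]) force
    qed
    then have least: "?P (LEAST m. ?P m)" by (rule LeastI_ex)
    define m where "m = (LEAST m. ?P m)"
    from least obtain N2 v where v: "v \<in> L N2" "v s = int m" and m: "m > 0"
      unfolding m_def by blast
    have "L k = L (max N1 N2)" if k: "k \<ge> max N1 N2" for k
    proof
      show "L (max N1 N2) \<subseteq> L k" using mono k by blast
      show "L k \<subseteq> L (max N1 N2)"
      proof
        fix u assume u: "u \<in> L k"
        \<comment> \<open>Division with remainder by \<open>v\<close> in the last coordinate leaves an element of \<open>K k\<close>.\<close>
        define q where "q = u s div v s"
        define r where "r = (\<lambda>i. u i - q * v i)"
        have vk: "v \<in> L k" and vN: "v \<in> L (max N1 N2)" using v mono k by (meson max.bounded_iff max.cobounded2 subsetD)+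
        have r: "r \<in> L k"
          unfolding r_def
          using int_subgroup_diff[OF Suc.prems(1) u int_subgroup_scale[OF Suc.prems(1) vk, of q]] .
        have rs: "r s = u s mod v s"
          by (simp add: r_def q_def minus_div_mult_eq_mod)
        have "r s = 0"
        proof (rule ccontr)
          assume "r s \<noteq> 0"
          moreover have "0 \<le> r s" "r s < int m" unfolding rs v(2) using m by simp_all
          ultimately have "?P (nat (r s))" "nat (r s) < m"
            using r by (auto intro!: exI[of _ k] bexI[of _ r])
          then show False unfolding m_def using not_less_Least by blast
        qed
        then have "r \<in> K k" using r by (simp add: K_def)
        then have "r \<in> L (max N1 N2)" using N1[of k] N1[of "max N1 N2"] k by (auto simp: K_def)
        then have "(\<lambda>i. r i + q * v i) \<in> L (max N1 N2)"
          by (intro int_subgroup_add[OF Suc.prems(1)] int_subgroup_scale[OF Suc.prems(1)] vN)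
        then show "u \<in> L (max N1 N2)" by (simp add: r_def)
      qed
    qed
    then show ?thesis by blast
  qed
qed


section \<open>Points whose powers have a nonnegative coordinate sum\<close>

text \<open>
  The set \<open>nonneg_points s\<close> is the set \<open>X\<close> of the introduction. The operations \<open>solutions\<close> and
  \<open>relations\<close> form the duality between sets of exponent vectors and sets of points; \<open>relations s
  (solutions s F)\<close> is the subgroup of all consequences of the relations \<open>F\<close>, and its growth is what
  bounds the splitting process.
\<close>

definition nonneg_points :: "nat \<Rightarrow> (nat \<Rightarrow> complex) set" where
  "nonneg_points s = {z \<in> torus s. \<forall>n. 0 \<le> Re (\<Sum>i<s. z i ^ n)}"

definition solutions :: "nat \<Rightarrow> (nat \<Rightarrow> int) set \<Rightarrow> (nat \<Rightarrow> complex) set" where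
  "solutions s F = {z \<in> torus s. \<forall>v\<in>F. character s v z = 1}"

definition relations :: "nat \<Rightarrow> (nat \<Rightarrow> complex) set \<Rightarrow> (nat \<Rightarrow> int) set" where
  "relations s W = {v \<in> int_vecs s. \<forall>z\<in>W. character s v z = 1}"

lemma int_subgroup_relations:
  assumes "W \<subseteq> torus s"
  shows "int_subgroup s (relations s W)"
  using assms by (auto simp: int_subgroup_def relations_def int_vecs_def character_zero character_diff subset_iff)

lemma wf_larger_relations:
  "wf {(F, G). relations s (solutions s G) \<subset> relations s (solutions s F)}"
  unfolding wf_iff_no_infinite_down_chain
proof
  assume "\<exists>f. \<forall>k. (f (Suc k), f k) \<in> {(F, G). relations s (solutions s G) \<subset> relations s (solutions s F)}"
  then obtain f where f: "\<And>k. relations s (solutions s (f k)) \<subset> relations s (solutions s (f (Suc k)))"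
    by auto
  have "\<exists>N. \<forall>k\<ge>N. relations s (solutions s (f k)) = relations s (solutions s (f N))"
    by (rule int_subgroup_chain_stabilizes[OF int_subgroup_relations]) (use f in \<open>auto simp: solutions_def\<close>)
  then obtain N where "relations s (solutions s (f (Suc N))) = relations s (solutions s (f N))"
    by (meson le_SucI le_refl)
  with f[of N] show False by simp
qed

lemma solutions_power: "w \<in> solutions s F \<Longrightarrow> (\<lambda>i. w i ^ n) \<in> solutions s F"
  by (simp add: solutions_def torus_power character_power_point)

text \<open>
  If all relations of \<open>z\<close> up to size \<open>N\<close> held at \<open>w\<close>, some power of \<open>z\<close> would be so close to \<open>w\<close> that its
  coordinate sum has negative real part. It matters that \<open>N\<close> is chosen before \<open>z\<close>: this leaves
  finitely many candidates for the failing relation.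
\<close>

lemma nonneg_points_miss_relation:
  assumes w: "w \<in> torus s" and neg: "Re (\<Sum>i<s. w i) < 0"
  obtains N where "\<And>z. z \<in> nonneg_points s \<Longrightarrow>
    \<exists>v\<in>int_box s N. character s v z = 1 \<and> character s v w \<noteq> 1"
proof -
  have s: "s > 0" using neg by (cases s) auto
  define \<epsilon> where "\<epsilon> = - Re (\<Sum>i<s. w i) / real s"
  have \<epsilon>: "\<epsilon> > 0" using neg s unfolding \<epsilon>_def by (intro divide_pos_pos) auto
  obtain N where N: "\<And>z w. z \<in> torus s \<Longrightarrow> w \<in> torus s \<Longrightarrow>
      (\<And>v. v \<in> int_box s N \<Longrightarrow> character s v z = 1 \<Longrightarrow> character s v w = 1) \<Longrightarrow>
      \<exists>n. \<forall>i<s. cmod (z i ^ n - w i) < \<epsilon>"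
    using uniform_kronecker[OF \<epsilon>, of s] by blast
  have "\<exists>v\<in>int_box s N. character s v z = 1 \<and> character s v w \<noteq> 1" if z: "z \<in> nonneg_points s" for z
  proof (rule ccontr)
    assume "\<not> ?thesis"
    then obtain n where n: "\<And>i. i < s \<Longrightarrow> cmod (z i ^ n - w i) < \<epsilon>"
      using N[OF _ w, of z] z by (auto simp: nonneg_points_def)
    have "Re (\<Sum>i<s. z i ^ n) - Re (\<Sum>i<s. w i) = (\<Sum>i<s. Re (z i ^ n - w i))"
      by (simp only: sum_subtractf minus_complex.sel Re_sum)
    also have "\<dots> < (\<Sum>i<s. \<epsilon>)"
      using s n by (intro sum_strict_mono) (auto simp del: minus_complex.sel intro: le_less_trans[OF complex_Re_le_cmod])
    also have "\<dots> = - Re (\<Sum>i<s. w i)" using s by (simp add: \<epsilon>_def)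
    finally have "Re (\<Sum>i<s. z i ^ n) < 0" by simp
    moreover have "0 \<le> Re (\<Sum>i<s. z i ^ n)"
      using z unfolding nonneg_points_def by blast
    ultimately show False by simp
  qed
  then show ?thesis using that by blast
qed

text \<open>
  Noetherian induction on the subgroup of consequences of \<open>F\<close>. A subgroup that leaves \<open>nonneg_points\<close> is
  replaced by the finitely many subgroups obtained from adding one short relation that fails at a
  bad point of it.
\<close>

lemma nonneg_points_cover:
  assumes "finite F"
  shows "\<exists>\<H>. finite \<H> \<and> (\<forall>G\<in>\<H>. finite G \<and> solutions s G \<subseteq> nonneg_points s) \<and>
    nonneg_points s \<inter> solutions s F \<subseteq> (\<Union>G\<in>\<H>. solutions s G)"
  using assms
proof (induction F rule: wf_induct_rule[OF wf_larger_relations[of s]])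
  case (1 F)
  show ?case
  proof (cases "solutions s F \<subseteq> nonneg_points s")
    case True
    then show ?thesis using "1.prems" by (intro exI[of _ "{F}"]) auto
  next
    case False
    then obtain w' where w': "w' \<in> solutions s F" "w' \<notin> nonneg_points s" by blast
    then obtain n where n: "Re (\<Sum>i<s. w' i ^ n) < 0"
      unfolding nonneg_points_def solutions_def mem_Collect_eq by (meson not_le)
    define w where "w = (\<lambda>i. w' i ^ n)"
    have w: "w \<in> solutions s F" "Re (\<Sum>i<s. w i) < 0"
      using solutions_power[OF w'(1)] n by (simp_all add: w_def)
    have wt: "w \<in> torus s" using w by (simp add: solutions_def)
    obtain N where N: "\<And>z. z \<in> nonneg_points s \<Longrightarrow>
        \<exists>v\<in>int_box s N. character s v z = 1 \<and> character s v w \<noteq> 1"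
      using nonneg_points_miss_relation[OF wt w(2)] by blast
    define B where "B = {v \<in> int_box s N. character s v w \<noteq> 1}"
    have B: "finite B" using finite_int_box by (simp add: B_def)
    have "\<exists>\<H>. finite \<H> \<and> (\<forall>G\<in>\<H>. finite G \<and> solutions s G \<subseteq> nonneg_points s) \<and>
        nonneg_points s \<inter> solutions s (insert v F) \<subseteq> (\<Union>G\<in>\<H>. solutions s G)" if v: "v \<in> B" for v
    proof (rule "1.IH")
      have "v \<in> relations s (solutions s (insert v F))"
        using v by (auto simp: relations_def solutions_def B_def int_box_def)
      moreover have "v \<notin> relations s (solutions s F)"
        using v w by (auto simp: relations_def B_def)
      moreover have "relations s (solutions s F) \<subseteq> relations s (solutions s (insert v F))"
        by (auto simp: relations_def solutions_def)
      ultimately show "(insert v F, F) \<in> {(F, G). relations s (solutions s G) \<subset> relations s (solutions s F)}"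
        by blast
    qed (use "1.prems" in simp)
    then obtain \<H> where \<H>: "\<And>v. v \<in> B \<Longrightarrow> finite (\<H> v)"
      "\<And>v G. v \<in> B \<Longrightarrow> G \<in> \<H> v \<Longrightarrow> finite G \<and> solutions s G \<subseteq> nonneg_points s"
      "\<And>v. v \<in> B \<Longrightarrow> nonneg_points s \<inter> solutions s (insert v F) \<subseteq> (\<Union>G\<in>\<H> v. solutions s G)"
      by metis
    have "nonneg_points s \<inter> solutions s F \<subseteq> (\<Union>G\<in>(\<Union>v\<in>B. \<H> v). solutions s G)"
    proof
      fix z assume z: "z \<in> nonneg_points s \<inter> solutions s F"
      then obtain v where v: "v \<in> int_box s N" "character s v z = 1" "character s v w \<noteq> 1"
        using N by blast
      then have "v \<in> B" "z \<in> nonneg_points s \<inter> solutions s (insert v F)"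
        using z by (auto simp: B_def solutions_def)
      then show "z \<in> (\<Union>G\<in>(\<Union>v\<in>B. \<H> v). solutions s G)" using \<H>(3) by blast
    qed
    then show ?thesis
      using B \<H>(1,2) by (intro exI[of _ "\<Union>v\<in>B. \<H> v"]) auto
  qed
qed

theorem nonneg_points_finite_union:
  "\<exists>\<H>. finite \<H> \<and> (\<forall>F\<in>\<H>. finite F) \<and> nonneg_points s = (\<Union>F\<in>\<H>. solutions s F)"
proof -
  obtain \<H> where "finite \<H>" "\<forall>G\<in>\<H>. finite G \<and> solutions s G \<subseteq> nonneg_points s"
    "nonneg_points s \<inter> solutions s {} \<subseteq> (\<Union>G\<in>\<H>. solutions s G)"
    using nonneg_points_cover[of "{}" s] by auto
  moreover have "nonneg_points s \<subseteq> solutions s {}"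
    by (auto simp: solutions_def nonneg_points_def)
  ultimately show ?thesis by (intro exI[of _ \<H>]) blast
qed


section \<open>Symmetrising Laurent polynomials\<close>

text \<open>
  Integer polynomials as syntax, so that the same polynomial can be evaluated at complex power sums and
  at rational moments. The variables are indexed by the order of a power sum, which may be negative.
\<close>

datatype poly_expr = Const int | Var int | Add poly_expr poly_expr | Mult poly_expr poly_expr

fun poly_eval :: "(int \<Rightarrow> 'a::comm_ring_1) \<Rightarrow> poly_expr \<Rightarrow> 'a" where
  "poly_eval p (Const k) = of_int k"
| "poly_eval p (Var m) = p m"
| "poly_eval p (Add a b) = poly_eval p a + poly_eval p b"
| "poly_eval p (Mult a b) = poly_eval p a * poly_eval p b"

definition power_sum :: "nat \<Rightarrow> (nat \<Rightarrow> complex) \<Rightarrow> int \<Rightarrow> complex" where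
  "power_sum s z m = (\<Sum>i<s. z i powi m)"

definition power_sum_poly :: "nat \<Rightarrow> ((nat \<Rightarrow> complex) \<Rightarrow> complex) \<Rightarrow> bool" where
  "power_sum_poly s f \<longleftrightarrow> (\<exists>e. \<forall>z\<in>torus s. f z = poly_eval (power_sum s z) e)"

lemma power_sum_poly_cong:
  assumes "power_sum_poly s g" and "\<And>z. z \<in> torus s \<Longrightarrow> f z = g z"
  shows "power_sum_poly s f"
  using assms by (simp add: power_sum_poly_def)

lemma power_sum_poly_of_int: "power_sum_poly s (\<lambda>_. of_int k)"
  unfolding power_sum_poly_def by (rule exI[of _ "Const k"]) simp

lemma power_sum_poly_power_sum: "power_sum_poly s (\<lambda>z. power_sum s z m)"
  unfolding power_sum_poly_def by (rule exI[of _ "Var m"]) simp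

lemma power_sum_poly_add:
  assumes "power_sum_poly s f" and "power_sum_poly s g"
  shows "power_sum_poly s (\<lambda>z. f z + g z)"
proof -
  obtain a b where "\<forall>z\<in>torus s. f z = poly_eval (power_sum s z) a"
    "\<forall>z\<in>torus s. g z = poly_eval (power_sum s z) b"
    using assms unfolding power_sum_poly_def by blast
  then show ?thesis
    unfolding power_sum_poly_def by (intro exI[of _ "Add a b"]) simp
qed

lemma power_sum_poly_mult:
  assumes "power_sum_poly s f" and "power_sum_poly s g"
  shows "power_sum_poly s (\<lambda>z. f z * g z)"
proof -
  obtain a b where "\<forall>z\<in>torus s. f z = poly_eval (power_sum s z) a"
    "\<forall>z\<in>torus s. g z = poly_eval (power_sum s z) b"
    using assms unfolding power_sum_poly_def by blast
  then show ?thesis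
    unfolding power_sum_poly_def by (intro exI[of _ "Mult a b"]) simp
qed

lemma power_sum_poly_diff:
  assumes "power_sum_poly s f" and "power_sum_poly s g"
  shows "power_sum_poly s (\<lambda>z. f z - g z)"
proof -
  have "power_sum_poly s (\<lambda>z. f z + of_int (- 1) * g z)"
    by (intro power_sum_poly_add power_sum_poly_mult power_sum_poly_of_int assms)
  then show ?thesis by simp
qed

lemma power_sum_poly_sum:
  assumes "finite I" and "\<And>i. i \<in> I \<Longrightarrow> power_sum_poly s (f i)"
  shows "power_sum_poly s (\<lambda>z. \<Sum>i\<in>I. f i z)"
  using assms
proof (induction I rule: finite_induct)
  case empty
  show ?case using power_sum_poly_of_int[of s 0] by simp
next
  case (insert i I)
  then show ?case by (auto intro: power_sum_poly_add)
qed

text \<open>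
  Lists without repetition serve as injective maps from \<open>{..<k}\<close> to \<open>{..<s}\<close>; for \<open>k = s\<close> they are
  the permutations of the coordinates.
\<close>

definition distinct_lists :: "nat \<Rightarrow> nat \<Rightarrow> nat list set" where
  "distinct_lists s k = {xs. length xs = k \<and> distinct xs \<and> set xs \<subseteq> {..<s}}"

lemma finite_distinct_lists: "finite (distinct_lists s k)"
  by (rule finite_subset[OF _ finite_lists_length_eq[of "{..<s}" k]]) (auto simp: distinct_lists_def)

definition symmetric_monomial :: "nat \<Rightarrow> nat \<Rightarrow> (nat \<Rightarrow> int) \<Rightarrow> (nat \<Rightarrow> complex) \<Rightarrow> complex" where
  "symmetric_monomial s k v z = (\<Sum>xs\<in>distinct_lists s k. \<Prod>l<k. z (xs ! l) powi v l)"

lemma distinct_lists_Suc: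
  "distinct_lists s (Suc k) = (\<lambda>(xs, j). xs @ [j]) ` (SIGMA xs : distinct_lists s k. {..<s} - set xs)"
proof
  show "distinct_lists s (Suc k) \<subseteq> (\<lambda>(xs, j). xs @ [j]) ` (SIGMA xs : distinct_lists s k. {..<s} - set xs)"
  proof
    fix ys assume ys: "ys \<in> distinct_lists s (Suc k)"
    then have "ys \<noteq> []" by (auto simp: distinct_lists_def)
    then obtain xs j where xsj: "ys = xs @ [j]" by (meson rev_exhaust)
    then have "(xs, j) \<in> (SIGMA xs : distinct_lists s k. {..<s} - set xs)"
      using ys by (auto simp: distinct_lists_def)
    then show "ys \<in> (\<lambda>(xs, j). xs @ [j]) ` (SIGMA xs : distinct_lists s k. {..<s} - set xs)"
      unfolding xsj by force
  qed
qed (auto simp: distinct_lists_def)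

text \<open>
  Choosing the last coordinate freely contributes the power sum; the choices that repeat the
  coordinate at position \<open>l\<close> merge two factors and add their exponents, and are subtracted. This recursion
  expresses symmetrised monomials through power sums.
\<close>

lemma symmetric_monomial_Suc:
  assumes "z \<in> torus s"
  shows "symmetric_monomial s (Suc k) v z = symmetric_monomial s k v z * power_sum s z (v k)
    - (\<Sum>l<k. symmetric_monomial s k (v(l := v l + v k)) z)"
proof -
  let ?m = "\<lambda>xs. \<Prod>l<k. z (xs ! l) powi v l"
  have inner: "(\<Sum>j\<in>{..<s} - set xs. (\<Prod>l<Suc k. z ((xs @ [j]) ! l) powi v l))
      = ?m xs * power_sum s z (v k) - (\<Sum>l<k. \<Prod>l'<k. z (xs ! l') powi (v(l := v l + v k)) l')"
    if xs: "xs \<in> distinct_lists s k" for xs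
  proof -
    have len: "length xs = k" and dist: "distinct xs" and sub: "set xs \<subseteq> {..<s}"
      using xs by (auto simp: distinct_lists_def)
    have "(\<Sum>j\<in>{..<s} - set xs. (\<Prod>l<Suc k. z ((xs @ [j]) ! l) powi v l))
        = (\<Sum>j\<in>{..<s} - set xs. ?m xs * z j powi v k)"
      using len by (intro sum.cong refl) (simp add: nth_append)
    also have "\<dots> = ?m xs * (power_sum s z (v k) - (\<Sum>j\<in>set xs. z j powi v k))"
      using sub by (simp add: sum_diff power_sum_def flip: sum_distrib_left)
    also have "(\<Sum>j\<in>set xs. z j powi v k) = (\<Sum>l<k. z (xs ! l) powi v k)"
      using sum.reindex_bij_betw[OF bij_betw_nth[OF dist, of "{..<k}" "set xs"], where g = "\<lambda>j. z j powi v k"] len by simp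
    also have "?m xs * (power_sum s z (v k) - (\<Sum>l<k. z (xs ! l) powi v k))
        = ?m xs * power_sum s z (v k) - (\<Sum>l<k. ?m xs * z (xs ! l) powi v k)"
      by (simp add: right_diff_distrib sum_distrib_left)
    also have "(\<Sum>l<k. ?m xs * z (xs ! l) powi v k)
        = (\<Sum>l<k. \<Prod>l'<k. z (xs ! l') powi (v(l := v l + v k)) l')"
    proof (rule sum.cong[OF refl])
      fix l assume "l \<in> {..<k}"
      then have l: "l < k" by simp
      have "xs ! l \<in> set xs" using l len by simp
      then have "xs ! l < s" using sub by blast
      then have nz: "z (xs ! l) \<noteq> 0" using assms torus_nonzero by blast
      have "(\<Prod>l'<k. z (xs ! l') powi (v(l := v l + v k)) l')
          = z (xs ! l) powi (v l + v k) * (\<Prod>l'\<in>{..<k} - {l}. z (xs ! l') powi v l')"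
        using l by (subst prod.remove[of _ l]) (auto intro!: prod.cong)
      also have "\<dots> = ?m xs * z (xs ! l) powi v k"
        using l nz by (subst (2) prod.remove[of _ l]) (auto simp: power_int_add mult_ac)
      finally show "?m xs * z (xs ! l) powi v k
          = (\<Prod>l'<k. z (xs ! l') powi (v(l := v l + v k)) l')" ..
    qed
    finally show ?thesis .
  qed
  have inj: "inj_on (\<lambda>(xs, j). xs @ [j]) (SIGMA xs : distinct_lists s k. {..<s} - set xs)"
    by (auto simp: inj_on_def)
  have "symmetric_monomial s (Suc k) v z = (\<Sum>xs\<in>distinct_lists s k. \<Sum>j\<in>{..<s} - set xs.
      \<Prod>l<Suc k. z ((xs @ [j]) ! l) powi v l)"
    unfolding symmetric_monomial_def distinct_lists_Suc sum.reindex[OF inj] comp_def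
    by (simp add: sum.Sigma finite_distinct_lists case_prod_unfold del: prod.lessThan_Suc)
  also have "\<dots> = (\<Sum>xs\<in>distinct_lists s k. ?m xs * power_sum s z (v k)
      - (\<Sum>l<k. \<Prod>l'<k. z (xs ! l') powi (v(l := v l + v k)) l'))"
    by (intro sum.cong refl inner)
  also have "\<dots> = symmetric_monomial s k v z * power_sum s z (v k)
      - (\<Sum>xs\<in>distinct_lists s k. \<Sum>l<k. \<Prod>l'<k. z (xs ! l') powi (v(l := v l + v k)) l')"
    by (simp add: symmetric_monomial_def sum_subtractf sum_distrib_right)
  also have "(\<Sum>xs\<in>distinct_lists s k. \<Sum>l<k. \<Prod>l'<k. z (xs ! l') powi (v(l := v l + v k)) l')
      = (\<Sum>l<k. symmetric_monomial s k (v(l := v l + v k)) z)"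
    unfolding symmetric_monomial_def by (rule sum.swap)
  finally show ?thesis .
qed

lemma power_sum_poly_symmetric_monomial: "power_sum_poly s (symmetric_monomial s k v)"
proof (induction k arbitrary: v)
  case 0
  have "distinct_lists s 0 = {[]}" by (auto simp: distinct_lists_def)
  then have "symmetric_monomial s 0 v = (\<lambda>_. of_int 1)"
    by (simp add: symmetric_monomial_def fun_eq_iff)
  then show ?case using power_sum_poly_of_int by metis
next
  case (Suc k)
  have "power_sum_poly s (\<lambda>z. symmetric_monomial s k v z * power_sum s z (v k)
      - (\<Sum>l<k. symmetric_monomial s k (v(l := v l + v k)) z))"
    by (intro power_sum_poly_diff power_sum_poly_mult power_sum_poly_power_sum power_sum_poly_sum Suc) simp
  then show ?case by (rule power_sum_poly_cong) (rule symmetric_monomial_Suc)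
qed

definition laurent :: "nat \<Rightarrow> ((nat \<Rightarrow> complex) \<Rightarrow> complex) \<Rightarrow> bool" where
  "laurent s f \<longleftrightarrow> (\<exists>ts :: (int \<times> (nat \<Rightarrow> int)) list.
    \<forall>z\<in>torus s. f z = (\<Sum>(c, v)\<leftarrow>ts. of_int c * character s v z))"

lemma laurent_term: "laurent s (\<lambda>z. of_int c * character s v z)"
  unfolding laurent_def by (rule exI[of _ "[(c, v)]"]) simp

lemma laurent_of_int: "laurent s (\<lambda>_. of_int c)"
  using laurent_term[of s c "\<lambda>_. 0"] by (simp add: character_zero)

lemma laurent_add:
  assumes "laurent s f" and "laurent s g"
  shows "laurent s (\<lambda>z. f z + g z)"
proof -
  obtain ts us where "\<forall>z\<in>torus s. f z = (\<Sum>(c, v)\<leftarrow>ts. of_int c * character s v z)"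
    "\<forall>z\<in>torus s. g z = (\<Sum>(c, v)\<leftarrow>us. of_int c * character s v z)"
    using assms unfolding laurent_def by blast
  then show ?thesis
    unfolding laurent_def by (intro exI[of _ "ts @ us"]) simp
qed

lemma laurent_mult:
  assumes "laurent s f" and "laurent s g"
  shows "laurent s (\<lambda>z. f z * g z)"
proof -
  obtain ts us where f: "\<forall>z\<in>torus s. f z = (\<Sum>(c, v)\<leftarrow>ts. of_int c * character s v z)"
    and g: "\<forall>z\<in>torus s. g z = (\<Sum>(c, v)\<leftarrow>us. of_int c * character s v z)"
    using assms unfolding laurent_def by blast
  let ?prod = "concat (map (\<lambda>(c, v). map (\<lambda>(d, w). (c * d, \<lambda>i. v i + w i)) us) ts)"
  have single: "(\<Sum>(d, w)\<leftarrow>map (\<lambda>(d, w). (c * d, \<lambda>i. v i + w i)) us. of_int d * character s w z)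
      = of_int c * character s v z * (\<Sum>(d, w)\<leftarrow>us. of_int d * character s w z)"
    if "z \<in> torus s" for c v and z
    using that by (induction us) (auto simp: character_add algebra_simps)
  have "(\<Sum>(c, v)\<leftarrow>ts. of_int c * character s v z) * (\<Sum>(c, v)\<leftarrow>us. of_int c * character s v z)
      = (\<Sum>(c, v)\<leftarrow>?prod. of_int c * character s v z)"
    if z: "z \<in> torus s" for z
  proof (induction ts)
    case Nil
    show ?case by simp
  next
    case (Cons t ts)
    obtain c v where t: "t = (c, v)" by fastforce
    show ?case
      unfolding t by (simp only: list.map concat.simps map_append sum_list_append sum_list.Cons
          prod.case distrib_right Cons single[OF z])
  qed
  then show ?thesis
    unfolding laurent_def using f g by (intro exI[of _ ?prod]) simp
qed

lemma laurent_sum: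
  assumes "finite I" and "\<And>i. i \<in> I \<Longrightarrow> laurent s (f i)"
  shows "laurent s (\<lambda>z. \<Sum>i\<in>I. f i z)"
  using assms
proof (induction I rule: finite_induct)
  case empty
  show ?case using laurent_of_int[of s 0] by simp
next
  case (insert i I)
  then show ?case by (auto intro: laurent_add)
qed

lemma laurent_prod:
  assumes "finite I" and "\<And>i. i \<in> I \<Longrightarrow> laurent s (f i)"
  shows "laurent s (\<lambda>z. \<Prod>i\<in>I. f i z)"
  using assms
proof (induction I rule: finite_induct)
  case empty
  show ?case using laurent_of_int[of s 1] by simp
next
  case (insert i I)
  then show ?case by (auto intro: laurent_mult)
qed

lemma permuted_torus:
  assumes "z \<in> torus s" and "xs \<in> distinct_lists s s"
  shows "(\<lambda>i. z (xs ! i)) \<in> torus s"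
  using assms by (auto simp: torus_def distinct_lists_def subset_iff)

lemma power_sum_poly_symmetrised_laurent:
  assumes "laurent s f"
  shows "power_sum_poly s (\<lambda>z. \<Sum>xs\<in>distinct_lists s s. f (\<lambda>i. z (xs ! i)))"
proof -
  obtain ts where ts: "\<And>z. z \<in> torus s \<Longrightarrow> f z = (\<Sum>(c, v)\<leftarrow>ts. of_int c * character s v z)"
    using assms unfolding laurent_def by blast
  have "power_sum_poly s (\<lambda>z. \<Sum>(c, v)\<leftarrow>ts. of_int c * symmetric_monomial s s v z)"
  proof (induction ts)
    case Nil
    show ?case using power_sum_poly_of_int[of s 0] by simp
  next
    case (Cons t ts)
    then show ?case
      by (cases t) (auto intro!: power_sum_poly_add power_sum_poly_mult power_sum_poly_of_int
          power_sum_poly_symmetric_monomial)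
  qed
  then show ?thesis
  proof (rule power_sum_poly_cong)
    fix z assume z: "z \<in> torus s"
    have "(\<Sum>xs\<in>distinct_lists s s. f (\<lambda>i. z (xs ! i)))
        = (\<Sum>xs\<in>distinct_lists s s. \<Sum>(c, v)\<leftarrow>ts. of_int c * character s v (\<lambda>i. z (xs ! i)))"
      by (intro sum.cong refl ts permuted_torus z)
    also have "\<dots> = (\<Sum>(c, v)\<leftarrow>ts. of_int c * symmetric_monomial s s v z)"
      by (induction ts)
        (auto simp: sum.distrib symmetric_monomial_def character_def sum_distrib_left)
    finally show "(\<Sum>xs\<in>distinct_lists s s. f (\<lambda>i. z (xs ! i)))
        = (\<Sum>(c, v)\<leftarrow>ts. of_int c * symmetric_monomial s s v z)" .
  qed
qed

lemma permuted_nonneg_points: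
  assumes "xs \<in> distinct_lists s s" and z: "z \<in> torus s"
  shows "(\<lambda>i. z (xs ! i)) \<in> nonneg_points s \<longleftrightarrow> z \<in> nonneg_points s"
proof -
  have xs: "length xs = s" "distinct xs" "set xs \<subseteq> {..<s}"
    using assms by (auto simp: distinct_lists_def)
  have all: "set xs = {..<s}"
    using xs by (intro card_subset_eq) (auto simp: distinct_card)
  have "bij_betw ((!) xs) {..<s} {..<s}"
    by (rule bij_betw_nth[OF xs(2)]) (simp_all only: xs(1) all)
  then have "(\<Sum>i<s. z (xs ! i) ^ n) = (\<Sum>i<s. z i ^ n)" for n
    by (rule sum.reindex_bij_betw)
  then show ?thesis
    using z permuted_torus[OF z assms(1)] by (simp only: nonneg_points_def mem_Collect_eq)
qed

text \<open>
  The function \<open>R\<close> in the proof is real and nonnegative with zero set \<open>nonneg_points s\<close>, and \<open>Q\<close> writes it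
  as a Laurent polynomial. By nonnegativity the sum of \<open>R\<close> over all permutations of the coordinates
  vanishes only if every term does, and by invariance of \<open>nonneg_points s\<close> under permutations all
  terms vanish together.
\<close>

theorem nonneg_points_zero_set:
  "\<exists>e. \<forall>z\<in>torus s. z \<in> nonneg_points s \<longleftrightarrow> poly_eval (power_sum s z) e = 0"
proof -
  obtain \<H> where \<H>: "finite \<H>" "\<And>F. F \<in> \<H> \<Longrightarrow> finite F"
      "nonneg_points s = (\<Union>F\<in>\<H>. solutions s F)"
    using nonneg_points_finite_union[of s] by blast
  define R where "R z = (\<Prod>F\<in>\<H>. \<Sum>v\<in>F. (cmod (character s v z - 1))\<^sup>2)" for z
  define Q where "Q z = (\<Prod>F\<in>\<H>. \<Sum>v\<in>F. of_int 2
      + of_int (- 1) * character s v z + of_int (- 1) * character s (\<lambda>i. - v i) z)" for z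
  have Q: "laurent s Q"
    unfolding Q_def by (intro laurent_prod laurent_sum laurent_add laurent_term laurent_of_int \<H>)
  have QR: "Q z = of_real (R z)" if z: "z \<in> torus s" for z
  proof -
    have "of_int 2 + of_int (- 1) * c + of_int (- 1) * inverse c = complex_of_real ((cmod (c - 1))\<^sup>2)"
      if "cmod c = 1" for c :: complex
    proof -
      have "c * cnj c = 1" using that by (simp add: complex_norm_square[symmetric])
      moreover from this have "inverse c = cnj c" by (rule inverse_unique)
      ultimately show ?thesis
        unfolding complex_norm_square by (simp add: algebra_simps)
    qed
    then show ?thesis
      unfolding Q_def R_def of_real_prod of_real_sum
      by (intro prod.cong sum.cong refl) (simp only: character_uminus norm_character[OF z])
  qed
  have R0: "R z \<ge> 0" for z
    unfolding R_def by (intro prod_nonneg sum_nonneg) auto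
  have R: "R z = 0 \<longleftrightarrow> z \<in> nonneg_points s" if z: "z \<in> torus s" for z
  proof -
    have "R z = 0 \<longleftrightarrow> (\<exists>F\<in>\<H>. \<forall>v\<in>F. character s v z = 1)"
      using \<H>(1,2) by (auto simp: R_def sum_nonneg_eq_0_iff)
    then show ?thesis using z by (auto simp: \<H>(3) solutions_def)
  qed
  obtain e where e: "\<And>z. z \<in> torus s \<Longrightarrow>
      (\<Sum>xs\<in>distinct_lists s s. Q (\<lambda>i. z (xs ! i))) = poly_eval (power_sum s z) e"
    using power_sum_poly_symmetrised_laurent[OF Q] unfolding power_sum_poly_def by blast
  have "[0..<s] \<in> distinct_lists s s" by (auto simp: distinct_lists_def)
  then have ne: "distinct_lists s s \<noteq> {}" by blast
  have "z \<in> nonneg_points s \<longleftrightarrow> poly_eval (power_sum s z) e = 0" if z: "z \<in> torus s" for z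
  proof -
    have "poly_eval (power_sum s z) e = of_real (\<Sum>xs\<in>distinct_lists s s. R (\<lambda>i. z (xs ! i)))"
      unfolding e[OF z, symmetric] of_real_sum by (intro sum.cong refl QR permuted_torus z)
    then have "poly_eval (power_sum s z) e = 0 \<longleftrightarrow> (\<forall>xs\<in>distinct_lists s s. R (\<lambda>i. z (xs ! i)) = 0)"
      by (simp add: sum_nonneg_eq_0_iff finite_distinct_lists R0 flip: of_real_sum)
    also have "\<dots> \<longleftrightarrow> z \<in> nonneg_points s"
      using ne R[OF permuted_torus[OF z]] permuted_nonneg_points[OF _ z] by blast
    finally show ?thesis ..
  qed
  then show ?thesis by blast
qed


section \<open>Computable functions of an instance\<close>

definition computable :: "('a \<Rightarrow> nat list) \<Rightarrow> 'a set \<Rightarrow> ('a \<Rightarrow> nat) \<Rightarrow> bool" where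
  "computable code D f \<longleftrightarrow> (\<exists>p. \<forall>A\<in>D. computes p (code A) (f A))"

lemma computable_nth:
  assumes "\<And>A. A \<in> D \<Longrightarrow> i < length (code A)"
  shows "computable code D (\<lambda>A. code A ! i)"
  unfolding computable_def using assms by (blast intro: computes.proj)

lemma computes_Comp1:
  "computes g xs y \<Longrightarrow> computes f [y] z \<Longrightarrow> computes (Comp f [g]) xs z"
  by (rule computes.comp[where ys = "[y]"]) auto

lemma computes_Comp2:
  "computes g xs x \<Longrightarrow> computes h xs y \<Longrightarrow> computes f [x, y] z \<Longrightarrow> computes (Comp f [g, h]) xs z"
  by (rule computes.comp[where ys = "[x, y]"]) auto

lemma computes_Proj: "i < length xs \<Longrightarrow> xs ! i = y \<Longrightarrow> computes (Proj i) xs y"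
  using computes.proj by blast

lemma computable_comp1:
  assumes "computable code D f" and "\<And>n. computes p [n] (h n)"
  shows "computable code D (\<lambda>A. h (f A))"
  using assms unfolding computable_def by (meson computes_Comp1)

lemma computable_comp2:
  assumes "computable code D f" and "computable code D g" and "\<And>m n. computes p [m, n] (h m n)"
  shows "computable code D (\<lambda>A. h (f A) (g A))"
  using assms unfolding computable_def by (meson computes_Comp2)

definition rec_add :: recf where
  "rec_add = PrimRec (Proj 0) (Comp Succ [Proj 1])"

lemma computes_rec_add: "computes rec_add [m, n] (m + n)"
proof (induction m)
  case 0
  show ?case by (auto simp: rec_add_def intro!: computes.prim_0 computes_Proj)
next
  case (Suc m)
  have "computes (Comp Succ [Proj 1]) [m, m + n, n] (Suc (m + n))"
    by (rule computes_Comp1[OF _ computes.succ]) (auto intro: computes_Proj)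
  then have "computes (Comp Succ [Proj 1]) [m, m + n, n] (Suc m + n)"
    by simp
  then show ?case
    using Suc unfolding rec_add_def by (rule computes.prim_Suc[rotated])
qed

definition rec_mult :: recf where
  "rec_mult = PrimRec Zero (Comp rec_add [Proj 1, Proj 2])"

lemma computes_rec_mult: "computes rec_mult [m, n] (m * n)"
proof (induction m)
  case 0
  show ?case by (auto simp: rec_mult_def intro: computes.prim_0 computes.zero)
next
  case (Suc m)
  have "computes (Comp rec_add [Proj 1, Proj 2]) [m, m * n, n] (m * n + n)"
    by (rule computes_Comp2[OF _ _ computes_rec_add]) (auto intro: computes_Proj)
  then have "computes (Comp rec_add [Proj 1, Proj 2]) [m, m * n, n] (Suc m * n)"
    by (simp add: add.commute)
  then show ?case
    using Suc unfolding rec_mult_def by (rule computes.prim_Suc[rotated])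
qed

definition rec_pred :: recf where
  "rec_pred = PrimRec Zero (Proj 0)"

lemma computes_rec_pred: "computes rec_pred [n] (n - 1)"
proof (induction n)
  case 0
  show ?case by (auto simp: rec_pred_def intro: computes.prim_0 computes.zero)
next
  case (Suc n)
  have "computes (Proj 0) [n, n - 1] (Suc n - 1)"
    by (rule computes_Proj) auto
  then show ?case
    using Suc unfolding rec_pred_def by (rule computes.prim_Suc[rotated])
qed

text \<open>
  The recursion is on the first argument, which is therefore the subtrahend.
\<close>

definition rec_diff :: recf where
  "rec_diff = PrimRec (Proj 0) (Comp rec_pred [Proj 1])"

lemma computes_rec_diff: "computes rec_diff [m, n] (n - m)"
proof (induction m)
  case 0
  show ?case by (auto simp: rec_diff_def intro!: computes.prim_0 computes_Proj)
next
  case (Suc m)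
  have "computes (Comp rec_pred [Proj 1]) [m, n - m, n] (n - m - 1)"
    by (rule computes_Comp1[OF _ computes_rec_pred]) (auto intro: computes_Proj)
  then have "computes (Comp rec_pred [Proj 1]) [m, n - m, n] (n - Suc m)"
    by simp
  then show ?case
    using Suc unfolding rec_diff_def by (rule computes.prim_Suc[rotated])
qed

definition rec_is_zero :: recf where
  "rec_is_zero = PrimRec (Comp Succ [Zero]) Zero"

lemma computes_rec_is_zero: "computes rec_is_zero [n] (of_bool (n = 0))"
  unfolding rec_is_zero_def
proof (induction n)
  case 0
  show ?case
    using computes.succ[of 0] by (auto intro!: computes.prim_0 computes_Comp1 computes.zero)
next
  case (Suc n)
  have "computes Zero [n, of_bool (n = 0)] (of_bool (Suc n = 0))"
    using computes.zero by simp
  then show ?case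
    using Suc by (rule computes.prim_Suc[rotated])
qed

definition rec_parity :: recf where
  "rec_parity = PrimRec Zero (Comp rec_is_zero [Proj 1])"

lemma computes_rec_parity: "computes rec_parity [n] (n mod 2)"
proof (induction n)
  case 0
  show ?case by (auto simp: rec_parity_def intro: computes.prim_0 computes.zero)
next
  case (Suc n)
  have "computes (Comp rec_is_zero [Proj 1]) [n, n mod 2] (of_bool (n mod 2 = 0))"
    by (rule computes_Comp1[OF _ computes_rec_is_zero]) (auto intro: computes_Proj)
  also have "of_bool (n mod 2 = 0) = Suc n mod 2"
    by (cases "even n") (auto simp: mod_Suc)
  finally show ?case
    using Suc unfolding rec_parity_def by (rule computes.prim_Suc[rotated])
qed

definition rec_half :: recf where
  "rec_half = PrimRec Zero (Comp rec_add [Proj 1, Comp rec_parity [Proj 0]])"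

lemma computes_rec_half: "computes rec_half [n] (n div 2)"
proof (induction n)
  case 0
  show ?case by (auto simp: rec_half_def intro: computes.prim_0 computes.zero)
next
  case (Suc n)
  have "computes (Comp rec_add [Proj 1, Comp rec_parity [Proj 0]]) [n, n div 2] (n div 2 + n mod 2)"
    by (rule computes_Comp2[OF _ computes_Comp1[OF _ computes_rec_parity] computes_rec_add])
      (auto intro: computes_Proj)
  also have "n div 2 + n mod 2 = Suc n div 2"
    by presburger
  finally show ?case
    using Suc unfolding rec_half_def by (rule computes.prim_Suc[rotated])
qed

lemma computable_const: "computable code D (\<lambda>_. k)"
proof (induction k)
  case 0
  show ?case unfolding computable_def by (blast intro: computes.zero)
next
  case (Suc k)
  then show ?case by (rule computable_comp1[where h = Suc]) (rule computes.succ)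
qed

lemmas computable_add = computable_comp2[OF _ _ computes_rec_add]
lemmas computable_mult = computable_comp2[OF _ _ computes_rec_mult]
lemmas computable_diff = computable_comp2[OF _ _ computes_rec_diff]
lemmas computable_is_zero = computable_comp1[OF _ computes_rec_is_zero]
lemmas computable_parity = computable_comp1[OF _ computes_rec_parity]
lemmas computable_half = computable_comp1[OF _ computes_rec_half]


section \<open>Computable rational functions of an instance\<close>

text \<open>
  Rational values are represented by three computable natural numbers as \<open>(x - y) / z\<close>. The fraction need
  not be reduced and the sign is spread over \<open>x\<close> and \<open>y\<close>, so that sums and products only use addition
  and multiplication of natural numbers.
\<close>

definition rat_computable :: "('a \<Rightarrow> nat list) \<Rightarrow> 'a set \<Rightarrow> ('a \<Rightarrow> rat) \<Rightarrow> bool" where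
  "rat_computable code D g \<longleftrightarrow> (\<exists>x y z. computable code D x \<and> computable code D y \<and>
     computable code D z \<and>
     (\<forall>A\<in>D. z A \<noteq> 0 \<and> g A = (of_nat (x A) - of_nat (y A)) / of_nat (z A)))"

lemma rat_computable_cong:
  assumes "rat_computable code D g" and "\<And>A. A \<in> D \<Longrightarrow> f A = g A"
  shows "rat_computable code D f"
  using assms by (simp add: rat_computable_def)

lemma rat_computable_of_int: "rat_computable code D (\<lambda>_. of_int k)"
proof -
  have "of_int k = (of_nat (nat k) - of_nat (nat (- k)) :: rat) / of_nat 1"
    by (cases "k \<ge> 0") (auto simp: of_nat_nat)
  then show ?thesis
    unfolding rat_computable_def
    by (intro exI[of _ "\<lambda>_. nat k"] exI[of _ "\<lambda>_. nat (- k)"] exI[of _ "\<lambda>_. 1"])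
      (simp add: computable_const)
qed

lemma rat_computable_add:
  assumes "rat_computable code D f" and "rat_computable code D g"
  shows "rat_computable code D (\<lambda>A. f A + g A)"
proof -
  from assms(1) obtain x y z where f: "computable code D x" "computable code D y" "computable code D z"
    "\<And>A. A \<in> D \<Longrightarrow> z A \<noteq> 0 \<and> f A = (of_nat (x A) - of_nat (y A)) / of_nat (z A)"
    unfolding rat_computable_def by blast
  from assms(2) obtain x' y' z' where g: "computable code D x'" "computable code D y'" "computable code D z'"
    "\<And>A. A \<in> D \<Longrightarrow> z' A \<noteq> 0 \<and> g A = (of_nat (x' A) - of_nat (y' A)) / of_nat (z' A)"
    unfolding rat_computable_def by blast
  show ?thesis
    unfolding rat_computable_def
    by (intro exI[of _ "\<lambda>A. x A * z' A + x' A * z A"] exI[of _ "\<lambda>A. y A * z' A + y' A * z A"]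
        exI[of _ "\<lambda>A. z A * z' A"] conjI computable_add computable_mult f(1-3) g(1-3))
      (use f(4) g(4) in \<open>auto simp: field_simps\<close>)
qed

lemma rat_computable_mult:
  assumes "rat_computable code D f" and "rat_computable code D g"
  shows "rat_computable code D (\<lambda>A. f A * g A)"
proof -
  from assms(1) obtain x y z where f: "computable code D x" "computable code D y" "computable code D z"
    "\<And>A. A \<in> D \<Longrightarrow> z A \<noteq> 0 \<and> f A = (of_nat (x A) - of_nat (y A)) / of_nat (z A)"
    unfolding rat_computable_def by blast
  from assms(2) obtain x' y' z' where g: "computable code D x'" "computable code D y'" "computable code D z'"
    "\<And>A. A \<in> D \<Longrightarrow> z' A \<noteq> 0 \<and> g A = (of_nat (x' A) - of_nat (y' A)) / of_nat (z' A)"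
    unfolding rat_computable_def by blast
  show ?thesis
    unfolding rat_computable_def
    by (intro exI[of _ "\<lambda>A. x A * x' A + y A * y' A"] exI[of _ "\<lambda>A. x A * y' A + y A * x' A"]
        exI[of _ "\<lambda>A. z A * z' A"] conjI computable_add computable_mult f(1-3) g(1-3))
      (use f(4) g(4) in \<open>auto simp: field_simps\<close>)
qed

lemma rat_computable_sum:
  assumes "finite I" and "\<And>i. i \<in> I \<Longrightarrow> rat_computable code D (f i)"
  shows "rat_computable code D (\<lambda>A. \<Sum>i\<in>I. f i A)"
  using assms
proof (induction I rule: finite_induct)
  case empty
  show ?case using rat_computable_of_int[of _ _ 0] by simp
next
  case (insert i I)
  then show ?case by (auto intro: rat_computable_add)
qed

text \<open>
  With truncated subtraction, \<open>x = y\<close> holds if and only if \<open>(y - x) + (x - y) = 0\<close>.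
\<close>

lemma decidable_zero:
  assumes "rat_computable code D g"
  shows "decidable code D (\<lambda>A. g A = 0)"
proof -
  from assms obtain x y z where g: "computable code D x" "computable code D y"
    "\<And>A. A \<in> D \<Longrightarrow> z A \<noteq> 0 \<and> g A = (of_nat (x A) - of_nat (y A)) / of_nat (z A)"
    unfolding rat_computable_def by blast
  have "computable code D (\<lambda>A. of_bool ((y A - x A) + (x A - y A) = 0))"
    by (intro computable_is_zero computable_add computable_diff g(1,2))
  then obtain p where p: "\<And>A. A \<in> D \<Longrightarrow> computes p (code A) (of_bool ((y A - x A) + (x A - y A) = 0))"
    unfolding computable_def by blast
  have "of_bool ((y A - x A) + (x A - y A) = 0) = (if g A = 0 then 1 else 0 :: nat)" if "A \<in> D" for A
    using g(3)[OF that] by auto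
  then show ?thesis
    unfolding decidable_def using p by (intro exI[of _ p]) metis
qed

lemma length_concat_uniform:
  assumes "\<And>ys. ys \<in> set xss \<Longrightarrow> length ys = m"
  shows "length (concat xss) = length xss * m"
  using assms by (induction xss) auto

lemma nth_concat_uniform:
  assumes "\<And>ys. ys \<in> set xss \<Longrightarrow> length ys = m" and "i < length xss" and "j < m"
  shows "concat xss ! (i * m + j) = xss ! i ! j"
  using assms
proof (induction xss arbitrary: i)
  case Nil
  then show ?case by simp
next
  case (Cons ys xss)
  have "length ys = m" using Cons.prems by simp
  then show ?case
    using Cons by (cases i) (auto simp: nth_append)
qed

lemma mat_code_entry:
  assumes A: "A \<in> carrier_mat s s" and "i < s" and "j < s" and "k < 2"
  shows "(i * s + j) * 2 + k < length (mat_code A)"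
    and "mat_code A ! ((i * s + j) * 2 + k) = rat_code (A $$ (i, j)) ! k"
proof -
  have rows: "length (mat_to_list A) = s" "\<And>ys. ys \<in> set (mat_to_list A) \<Longrightarrow> length ys = s"
    "mat_to_list A ! i ! j = A $$ (i, j)"
    using A assms(2,3) by (auto simp: mat_to_list_def)
  have len: "length (concat (mat_to_list A)) = s * s"
    using length_concat_uniform[of "mat_to_list A" s] rows by simp
  have "i * s + j < i * s + s" using assms by simp
  also have "\<dots> = Suc i * s" by simp
  also have "\<dots> \<le> s * s" using assms(2) by (intro mult_right_mono) auto
  finally have bound: "i * s + j < s * s" .
  have "length (mat_code A) = s * s * 2"
    unfolding mat_code_def
    by (subst length_concat_uniform[where m = 2]) (auto simp: length_rat_code len)
  moreover have "x * 2 + k < y * 2" if "x < y" for x y :: nat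
    using that assms(4) by linarith
  ultimately show "(i * s + j) * 2 + k < length (mat_code A)"
    using bound by presburger
  have "mat_code A ! ((i * s + j) * 2 + k) =
      map rat_code (concat (mat_to_list A)) ! (i * s + j) ! k"
    unfolding mat_code_def
    by (rule nth_concat_uniform) (auto simp: length_rat_code len bound assms(4))
  also have "\<dots> = rat_code (concat (mat_to_list A) ! (i * s + j)) ! k"
    using bound len by simp
  also have "concat (mat_to_list A) ! (i * s + j) = A $$ (i, j)"
    using nth_concat_uniform[of "mat_to_list A" s i j] rows assms by simp
  finally show "mat_code A ! ((i * s + j) * 2 + k) = rat_code (A $$ (i, j)) ! k" .
qed

text \<open>
  The code of an integer is even for \<open>0, 1, 2, \<dots>\<close> and odd for \<open>-1, -2, \<dots>\<close>, the quotient by 2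
  counting through each list. Positive and negative part of the numerator are thus read off from the
  parity and the half of its code.
\<close>

lemma rat_computable_entry:
  assumes "i < s" and "j < s"
  shows "rat_computable mat_code (carrier_mat s s) (\<lambda>A. A $$ (i, j))"
proof -
  let ?D = "carrier_mat s s :: rat mat set"
  define num where "num A = mat_code A ! ((i * s + j) * 2)" for A
  define den where "den A = mat_code A ! ((i * s + j) * 2 + 1)" for A
  have num: "computable mat_code ?D num"
    unfolding num_def using mat_code_entry(1)[OF _ assms, of _ 0] by (intro computable_nth) simp
  have den: "computable mat_code ?D den"
    unfolding den_def using mat_code_entry(1)[OF _ assms, of _ 1] by (intro computable_nth) simp
  define pos where "pos A = (1 - num A mod 2) * (num A div 2)" for A
  define neg where "neg A = (num A mod 2) * (num A div 2 + 1)" for A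
  have "den A \<noteq> 0 \<and> A $$ (i, j) = (of_nat (pos A) - of_nat (neg A)) / of_nat (den A)"
    if A: "A \<in> ?D" for A
  proof -
    obtain a b where ab: "quotient_of (A $$ (i, j)) = (a, b)" by fastforce
    have b: "b > 0" using ab quotient_of_denom_pos by blast
    have n: "num A = int_encode a" and d: "den A = nat b"
      using mat_code_entry(2)[OF A assms, of 0] mat_code_entry(2)[OF A assms, of 1] ab
      by (auto simp: num_def den_def rat_code_def)
    have "a = int_decode (num A)" by (simp add: n)
    then have "a = int (pos A) - int (neg A)"
      by (cases "even (num A)")
        (auto simp: int_decode_def sum_decode_def pos_def neg_def odd_iff_mod_2_eq_one)
    then have "of_int a = of_nat (pos A) - (of_nat (neg A) :: rat)" by simp
    moreover have "A $$ (i, j) = of_int a / of_int b" using ab by (rule quotient_of_div)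
    ultimately show ?thesis using b d by (simp add: of_nat_nat)
  qed
  moreover have "computable mat_code ?D pos" "computable mat_code ?D neg"
    unfolding pos_def neg_def
    by (intro computable_mult computable_diff computable_add computable_const computable_half
        computable_parity num)+
  ultimately show ?thesis
    unfolding rat_computable_def using den by blast
qed

lemma rat_computable_moment: "rat_computable mat_code (carrier_mat s s) (moment n)"
proof -
  have entry: "rat_computable mat_code (carrier_mat s s) (\<lambda>A. (A ^\<^sub>m n) $$ (i, j))"
    if "i < s" "j < s" for i j
    using that
  proof (induction n arbitrary: i j)
    case 0
    show ?case
      by (rule rat_computable_cong[OF rat_computable_of_int[of _ _ "of_bool (i = j)"]])
        (use 0 in auto)
  next
    case (Suc n)
    have "rat_computable mat_code (carrier_mat s s) (\<lambda>A. \<Sum>k<s. (A ^\<^sub>m n) $$ (i, k) * A $$ (k, j))"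
      by (intro rat_computable_sum rat_computable_mult rat_computable_entry Suc) (use Suc.prems in auto)
    then show ?case
    proof (rule rat_computable_cong)
      fix A :: "rat mat" assume A: "A \<in> carrier_mat s s"
      show "(A ^\<^sub>m Suc n) $$ (i, j) = (\<Sum>k<s. (A ^\<^sub>m n) $$ (i, k) * A $$ (k, j))"
        using A Suc.prems pow_carrier_mat[OF A, of n]
        by (auto simp: scalar_prod_def lessThan_atLeast0 intro!: sum.cong)
    qed
  qed
  have "rat_computable mat_code (carrier_mat s s) (\<lambda>A. \<Sum>i<s. (A ^\<^sub>m n) $$ (i, i))"
    by (intro rat_computable_sum entry) auto
  then show ?thesis
  proof (rule rat_computable_cong)
    fix A :: "rat mat" assume A: "A \<in> carrier_mat s s"
    show "moment n A = (\<Sum>i<s. (A ^\<^sub>m n) $$ (i, i))"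
      using A pow_carrier_mat[OF A, of n] by (simp add: moment_def mat_trace_def)
  qed
qed


section \<open>Eigenvalues and moments of rational orthogonal matrices\<close>

lemma mat_trace_mult_comm:
  fixes A B :: "'a::comm_semiring_0 mat"
  assumes "A \<in> carrier_mat n n" and "B \<in> carrier_mat n n"
  shows "mat_trace (A * B) = mat_trace (B * A)"
proof -
  have "mat_trace (A * B) = (\<Sum>i<n. \<Sum>j<n. A $$ (i, j) * B $$ (j, i))"
    using assms by (simp add: mat_trace_def scalar_prod_def lessThan_atLeast0)
  also have "\<dots> = (\<Sum>j<n. \<Sum>i<n. A $$ (i, j) * B $$ (j, i))"
    by (rule sum.swap)
  also have "\<dots> = mat_trace (B * A)"
    using assms by (simp add: mat_trace_def scalar_prod_def lessThan_atLeast0 mult.commute)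
  finally show ?thesis .
qed

lemma upper_triangular_pow_entries:
  fixes T :: "'a::comm_semiring_1 mat"
  assumes T: "T \<in> carrier_mat n n" and "upper_triangular T" and i: "i < n"
  shows "j < i \<Longrightarrow> (T ^\<^sub>m k) $$ (i, j) = 0" and "(T ^\<^sub>m k) $$ (i, i) = T $$ (i, i) ^ k"
proof -
  have ut: "T $$ (a, b) = 0" if "b < a" "a < n" for a b
    using assms that by auto
  have "(\<forall>j<i. (T ^\<^sub>m k) $$ (i, j) = 0) \<and> (T ^\<^sub>m k) $$ (i, i) = T $$ (i, i) ^ k"
  proof (induction k)
    case 0
    show ?case using T i by simp
  next
    case (Suc k)
    have entry: "(T ^\<^sub>m Suc k) $$ (i, j) = (\<Sum>l<n. (T ^\<^sub>m k) $$ (i, l) * T $$ (l, j))" if "j < n" for j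
      using T i that pow_carrier_mat[OF T, of k] by (simp add: scalar_prod_def lessThan_atLeast0)
    have "(T ^\<^sub>m Suc k) $$ (i, j) = 0" if j: "j < i" for j
    proof -
      have "(T ^\<^sub>m k) $$ (i, l) * T $$ (l, j) = 0" if "l < n" for l
      proof (cases "l < i")
        case True
        then show ?thesis using Suc by simp
      next
        case False
        then show ?thesis using ut[of j l] j that by simp
      qed
      then show ?thesis using entry[of j] j i by simp
    qed
    moreover have "(T ^\<^sub>m Suc k) $$ (i, i) = T $$ (i, i) ^ Suc k"
    proof -
      have zero: "(T ^\<^sub>m k) $$ (i, l) * T $$ (l, i) = 0" if "l < n" "l \<noteq> i" for l
      proof (cases "l < i")
        case True
        then show ?thesis using Suc by simp
      next
        case False
        then show ?thesis using ut[of i l] that by simp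
      qed
      have "(T ^\<^sub>m Suc k) $$ (i, i) = (\<Sum>l\<in>{i}. (T ^\<^sub>m k) $$ (i, l) * T $$ (l, i))"
        unfolding entry[OF i] using i zero by (intro sum.mono_neutral_right) auto
      then show ?thesis using Suc by (simp add: mult.commute)
    qed
    ultimately show ?case by blast
  qed
  then show "j < i \<Longrightarrow> (T ^\<^sub>m k) $$ (i, j) = 0" and "(T ^\<^sub>m k) $$ (i, i) = T $$ (i, i) ^ k"
    by blast+
qed

text \<open>
  Over the complex numbers \<open>B\<close> is similar to an upper triangular matrix, whose powers have the powers of
  the eigenvalues on the diagonal.
\<close>

lemma moment_eq_eigenvalue_power_sum:
  fixes B :: "complex mat"
  assumes B: "B \<in> carrier_mat n n"
  obtains z where "\<And>i. i < n \<Longrightarrow> eigenvalue B (z i)" and "\<And>k. moment k B = (\<Sum>i<n. z i ^ k)"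
proof -
  obtain es where es: "char_poly B = (\<Prod>a\<leftarrow>es. [:- a, 1:])" "length es = n"
    using char_poly_factorized[OF B] by blast
  obtain T P Q where "schur_decomposition B es = (T, P, Q)"
    by (cases "schur_decomposition B es") auto
  from schur_decomposition[OF B es(1) this]
  have sim: "similar_mat_wit B T P Q" and ut: "upper_triangular T" and diag: "diag_mat T = es"
    by auto
  note simD = similar_mat_witD2[OF B sim]
  have "eigenvalue B (es ! i)" if "i < n" for i
  proof -
    have "poly (\<Prod>a\<leftarrow>es. [:- a, 1:]) (es ! i) = 0"
      using that es(2) by (auto simp: poly_prod_list prod_list_zero_iff image_iff intro!: bexI[of _ "es ! i"])
    then show ?thesis using eigenvalue_root_char_poly[OF B] es(1) by simp
  qed
  moreover have "moment k B = (\<Sum>i<n. (es ! i) ^ k)" for k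
  proof -
    have Tk: "T ^\<^sub>m k \<in> carrier_mat n n" using simD(5) by (rule pow_carrier_mat)
    have "moment k B = mat_trace (P * (T ^\<^sub>m k * Q))"
      unfolding moment_def similar_mat_wit_pow_id[OF sim] by (simp add: assoc_mult_mat[OF simD(6) Tk simD(7)])
    also have "\<dots> = mat_trace (T ^\<^sub>m k * Q * P)"
      using Tk simD by (intro mat_trace_mult_comm[of _ n]) auto
    also have "T ^\<^sub>m k * Q * P = T ^\<^sub>m k"
      using right_mult_one_mat[OF Tk] simD(2) by (simp add: assoc_mult_mat[OF Tk simD(7,6)])
    also have "mat_trace (T ^\<^sub>m k) = (\<Sum>i<n. T $$ (i, i) ^ k)"
      using simD(5) upper_triangular_pow_entries(2)[OF simD(5) ut] by (simp add: mat_trace_def)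
    also have "\<dots> = (\<Sum>i<n. (es ! i) ^ k)"
      using simD(5) by (intro sum.cong refl) (auto simp: diag[symmetric] diag_mat_def)
    finally show ?thesis .
  qed
  ultimately show ?thesis using that by blast
qed

text \<open>
  As \<open>B\<close> is real, the conjugate of an eigenvector for \<open>a\<close> is an eigenvector for the conjugate of \<open>a\<close>.
  As \<open>B\<close> preserves the bilinear form, \<open>v \<bullet> cnj v = |a|\<^sup>2 (v \<bullet> cnj v)\<close>.
\<close>

lemma norm_eigenvalue_real_orthogonal:
  fixes B :: "complex mat"
  assumes B: "B \<in> carrier_mat n n" and orth: "transpose_mat B * B = 1\<^sub>m n"
    and entries: "\<And>i j. i < n \<Longrightarrow> j < n \<Longrightarrow> cnj (B $$ (i, j)) = B $$ (i, j)"
    and ev: "eigenvalue B a"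
  shows "cmod a = 1"
proof -
  obtain v where v: "v \<in> carrier_vec n" "v \<noteq> 0\<^sub>v n" "B *\<^sub>v v = a \<cdot>\<^sub>v v"
    using ev B by (auto simp: eigenvalue_def eigenvector_def)
  let ?c = "conjugate v"
  have c: "?c \<in> carrier_vec n" using v by simp
  have Bc: "B *\<^sub>v ?c = cnj a \<cdot>\<^sub>v ?c"
  proof (rule eq_vecI)
    fix i assume "i < dim_vec (cnj a \<cdot>\<^sub>v ?c)"
    then have i: "i < n" using v by simp
    have "(B *\<^sub>v ?c) $ i = (\<Sum>j<n. B $$ (i, j) * cnj (v $ j))"
      using B v i by (simp add: scalar_prod_def lessThan_atLeast0)
    also have "\<dots> = cnj (\<Sum>j<n. B $$ (i, j) * v $ j)"
      using entries i by (simp add: cnj_sum)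
    also have "(\<Sum>j<n. B $$ (i, j) * v $ j) = (B *\<^sub>v v) $ i"
      using B v(1) i by (simp add: scalar_prod_def lessThan_atLeast0)
    also have "\<dots> = a * v $ i" using v i by simp
    finally show "(B *\<^sub>v ?c) $ i = (cnj a \<cdot>\<^sub>v ?c) $ i" using v i by simp
  qed (use B v in auto)
  have "v \<bullet> ?c = ?c \<bullet> v"
    using v by (simp add: comm_scalar_prod[of _ n])
  also have "\<dots> = (transpose_mat B *\<^sub>v (B *\<^sub>v ?c)) \<bullet> v"
    using B c by (simp add: assoc_mult_mat_vec[symmetric, of _ n n _ n] orth)
  also have "\<dots> = (B *\<^sub>v ?c) \<bullet> (B *\<^sub>v v)"
    using B v by (intro transpose_vec_mult_scalar) auto
  also have "\<dots> = cnj a * a * (?c \<bullet> v)"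
    unfolding v(3) Bc using v c by simp
  also have "?c \<bullet> v = v \<bullet> ?c"
    using v by (simp add: comm_scalar_prod[of _ n])
  finally have "v \<bullet> ?c = cnj a * a * (v \<bullet> ?c)" .
  moreover have "v \<bullet> ?c \<noteq> 0"
    using conjugate_square_eq_0_vec[OF v(1)] v(2) by simp
  ultimately have "cnj a * a = 1" by simp
  then have "complex_of_real ((cmod a)\<^sup>2) = 1"
    by (simp only: complex_norm_square mult.commute)
  then have "(cmod a)\<^sup>2 = 1" by (simp only: of_real_eq_1_iff)
  then show ?thesis by (simp add: power2_eq_1_iff) (metis norm_ge_zero neg_0_le_iff_le not_one_le_zero)
qed

lemma moment_of_rat:
  assumes A: "A \<in> carrier_mat n n"
  shows "moment k (map_mat of_rat A) = (of_rat (moment k A) :: 'a::field_char_0)"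
proof -
  have entry: "(map_mat of_rat A ^\<^sub>m k) $$ (i, j) = (of_rat ((A ^\<^sub>m k) $$ (i, j)) :: 'a)"
    if "i < n" "j < n" for i j
    using that
  proof (induction k arbitrary: j)
    case 0
    then show ?case using A by simp
  next
    case (Suc k)
    let ?A = "map_mat of_rat A :: 'a mat"
    have A': "?A \<in> carrier_mat n n" using A by simp
    have "(?A ^\<^sub>m Suc k) $$ (i, j) = (\<Sum>l<n. (?A ^\<^sub>m k) $$ (i, l) * ?A $$ (l, j))"
      using A' A Suc.prems pow_carrier_mat[OF A', of k] by (simp add: scalar_prod_def lessThan_atLeast0)
    also have "\<dots> = (\<Sum>l<n. of_rat ((A ^\<^sub>m k) $$ (i, l) * A $$ (l, j)))"
      using A Suc by (intro sum.cong refl) (simp add: of_rat_mult)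
    also have "\<dots> = of_rat ((A ^\<^sub>m Suc k) $$ (i, j))"
      using A Suc.prems pow_carrier_mat[OF A, of k] by (simp add: scalar_prod_def lessThan_atLeast0 of_rat_sum)
    finally show ?case .
  qed
  have "map_mat of_rat A ^\<^sub>m k \<in> (carrier_mat n n :: 'a mat set)"
    using A by (intro pow_carrier_mat) simp
  then show ?thesis
    using A pow_carrier_mat[OF A, of k] entry by (simp add: moment_def mat_trace_def of_rat_sum)
qed

text \<open>
  For negative orders, \<open>z\<^sub>i\<^sup>-\<^sup>1\<close> is the conjugate of \<open>z\<^sub>i\<close>, and the moments are real.
\<close>

lemma orthogonal_moments_power_sums:
  assumes "A \<in> orthogonal_group_rat s"
  obtains z where "z \<in> torus s" and "\<And>m. power_sum s z m = of_rat (moment (nat \<bar>m\<bar>) A)"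
proof -
  have A: "A \<in> carrier_mat s s" and orth: "transpose_mat A * A = 1\<^sub>m s"
    using assms by (auto simp: orthogonal_group_rat_def)
  let ?B = "map_mat of_rat A :: complex mat"
  have B: "?B \<in> carrier_mat s s" using A by simp
  have "transpose_mat ?B * ?B = 1\<^sub>m s"
  proof (rule eq_matI)
    fix i j assume "i < dim_row (1\<^sub>m s :: complex mat)" "j < dim_col (1\<^sub>m s :: complex mat)"
    then have ij: "i < s" "j < s" by auto
    have "(transpose_mat ?B * ?B) $$ (i, j) = of_rat ((transpose_mat A * A) $$ (i, j))"
      using A ij by (simp add: scalar_prod_def of_rat_sum of_rat_mult)
    then show "(transpose_mat ?B * ?B) $$ (i, j) = 1\<^sub>m s $$ (i, j)"
      unfolding orth using ij by simp
  qed (use A in auto)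
  moreover have cnj_rat: "cnj (of_rat q) = of_rat q" for q
    by (cases q) (simp add: of_rat_rat)
  ultimately have norm: "cmod a = 1" if "eigenvalue ?B a" for a
    using that A by (intro norm_eigenvalue_real_orthogonal[OF B]) auto
  obtain z where z: "\<And>i. i < s \<Longrightarrow> eigenvalue ?B (z i)" and mom: "\<And>k. moment k ?B = (\<Sum>i<s. z i ^ k)"
    using moment_eq_eigenvalue_power_sum[OF B] by blast
  have torus: "z \<in> torus s" using z norm by (simp add: torus_def)
  have sums: "(\<Sum>i<s. z i ^ k) = of_rat (moment k A)" for k
    using mom[of k] moment_of_rat[OF A, of k] by metis
  have "power_sum s z m = of_rat (moment (nat \<bar>m\<bar>) A)" for m
  proof (cases "m \<ge> 0")
    case True
    then have "power_sum s z m = (\<Sum>i<s. z i ^ nat m)" by (simp add: power_sum_def power_int_def)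
    then show ?thesis using True sums by simp
  next
    case False
    have "inverse (z i) = cnj (z i)" if "i < s" for i
    proof (rule inverse_unique)
      have "complex_of_real ((cmod (z i))\<^sup>2) = 1" using torusD[OF torus that] by simp
      then show "z i * cnj (z i) = 1" by (simp only: complex_norm_square)
    qed
    then have "power_sum s z m = cnj (\<Sum>i<s. z i ^ nat (- m))"
      using False by (simp add: power_sum_def power_int_def cnj_sum)
    then show ?thesis using False sums by (simp add: cnj_rat)
  qed
  then show ?thesis using torus that by blast
qed


section \<open>The decision procedure\<close>

lemma poly_eval_of_rat:
  "poly_eval (\<lambda>m. of_rat (p m)) e = (of_rat (poly_eval p e) :: 'a::field_char_0)"
  by (induction e) (auto simp: of_rat_add of_rat_mult)

theorem all_moments_nonneg_iff_zero:
  "\<exists>e. \<forall>A\<in>orthogonal_group_rat s.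
    all_moments_in {0..} A \<longleftrightarrow> poly_eval (\<lambda>m. moment (nat \<bar>m\<bar>) A) e = 0"
proof -
  obtain e where e: "\<And>z. z \<in> torus s \<Longrightarrow> z \<in> nonneg_points s \<longleftrightarrow> poly_eval (power_sum s z) e = 0"
    using nonneg_points_zero_set[of s] by blast
  have "all_moments_in {0..} A \<longleftrightarrow> poly_eval (\<lambda>m. moment (nat \<bar>m\<bar>) A) e = 0"
    if "A \<in> orthogonal_group_rat s" for A
  proof -
    obtain z where z: "z \<in> torus s" and sums: "\<And>m. power_sum s z m = of_rat (moment (nat \<bar>m\<bar>) A)"
      using orthogonal_moments_power_sums[OF \<open>A \<in> orthogonal_group_rat s\<close>] by blast
    have "(\<Sum>i<s. z i ^ n) = of_rat (moment n A)" for n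
      using sums[of "int n"] by (simp add: power_sum_def)
    moreover have "Re (of_rat q) = of_rat q" for q
      by (cases q) (simp add: of_rat_rat)
    ultimately have "0 \<le> Re (\<Sum>i<s. z i ^ n) \<longleftrightarrow> of_rat (moment n A) \<in> {0::real..}" for n
      by (simp only: atLeast_iff)
    then have "z \<in> nonneg_points s \<longleftrightarrow> all_moments_in {0..} A"
      using z by (simp only: nonneg_points_def all_moments_in_def mem_Collect_eq simp_thms)
    moreover have "power_sum s z = (\<lambda>m. of_rat (moment (nat \<bar>m\<bar>) A))"
      using sums by blast
    ultimately show ?thesis
      using e[OF z] by (simp add: poly_eval_of_rat)
  qed
  then show ?thesis by blast
qed

lemma rat_computable_poly_eval_moments:
  "rat_computable mat_code (carrier_mat s s) (\<lambda>A. poly_eval (\<lambda>m. moment (nat \<bar>m\<bar>) A) e)"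
  by (induction e)
    (auto intro: rat_computable_of_int rat_computable_add rat_computable_mult rat_computable_moment)

theorem theorem8:
  fixes s :: nat
  assumes "s \<ge> 1"
  shows "moment_positivity_decidable {0..} (orthogonal_group_rat s)"
proof -
  obtain e where e: "\<And>A. A \<in> orthogonal_group_rat s \<Longrightarrow>
      all_moments_in {0..} A \<longleftrightarrow> poly_eval (\<lambda>m. moment (nat \<bar>m\<bar>) A) e = 0"
    using all_moments_nonneg_iff_zero[of s] by blast
  obtain p where p: "\<And>A. A \<in> carrier_mat s s \<Longrightarrow>
      computes p (mat_code A) (if poly_eval (\<lambda>m. moment (nat \<bar>m\<bar>) A) e = 0 then 1 else 0)"
    using decidable_zero[OF rat_computable_poly_eval_moments[of s e]] unfolding decidable_def by blast
  have "computes p (mat_code A) (if all_moments_in {0..} A then 1 else 0)"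
    if A: "A \<in> orthogonal_group_rat s" for A
    using p[of A] e[OF A] A by (simp add: orthogonal_group_rat_def)
  then show ?thesis
    unfolding moment_positivity_decidable_def decidable_def by blast
qed

end
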